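(* Let $(X,W)$ be a bivariate stationary Gaussian random field on $\mathbb R$ with covariance $(K_{k\ell})_{k,\ell=1,2}$ such that each $K_{k\ell}$ satisfies condition $\mathrm A(L,c_{k\ell},\alpha_{k\ell})$ (defined in the context) for some $L>0$ with $\alpha_{k\ell}>0$, and assume $\alpha_{11}<\alpha_{12}$. Let $Y(s)=X(s)\beta+W(s)$. For each $n$, let $\mathcal S_n=\{s_0^{(n)}=0<s_1^{(n)}<\dots<s_n^{(n)}=L\}$ be an irregular grid with spacings $h_i^{(n)}=s_{i+1}^{(n)}-s_i^{(n)}$ satisfying $$\frac mn\le h_i^{(n)}\le\frac Mn\qquad(0\le i\le n-1)$$ for constants $0<m\le M<\infty$ independent of $n$. Write $h_i=h_i^{(n)}$, $s_i=s_i^{(n)}$, $\tilde h_i=(h_{i-1}+h_i)/2$, and define the spacing-weighted second-order difference operator $$(\Delta X)_i=\tilde h_i^{-1}\left(\frac{X(s_{i+1})-X(s_i)}{h_i}-\frac{X(s_i)-X(s_{i-1})}{h_{i-1}}\right),\qquad1\le i\le n-1,$$ and similarly $\Delta Y$. If $\alpha_{11}<4$, $\alpha_{11}\ne2$ and $\alpha_{22}>\alpha_{11}-1$, then $$\mathrm{OLS}_n(\Delta X,\Delta Y)=\frac{\sum_{i=1}^{n-1}(\Delta X)_i(\Delta Y)_i}{\sum_{i=1}^{n-1}(\Delta X)_i^2}\longrightarrow\beta\quad\text{in probability as }n\to\infty.$$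
   Context: Condition $\mathrm A(L,c,\alpha)$: $K(t)=A(t)+B(t)$, where $A$ is even and analytic and $B$ is even and continuous on $[-L,L]$; the $k$-th derivative $B^{(k)}$ on $(0,L]$ ($k\ge0$, $B^{(0)}=B$) satisfies, as $t\downarrow0$, $B^{(k)}(t)=(\alpha)_k\,c\,t^{\alpha-k}+o(t^{\alpha-k})$, where $c$ is a constant (non-zero for covariance functions), $\alpha>0$ is not an even integer, $(\alpha)_k=\Gamma(\alpha+1)/\Gamma(\alpha+1-k)$. Index $1$ refers to $X$, $2$ to $W$; $W$ is unobserved. *)

theory Defs
  imports "HOL-Probability.Probability"
begin

definition even_on :: "real set \<Rightarrow> (real \<Rightarrow> real) \<Rightarrow> bool" where
  "even_on S f \<longleftrightarrow> (\<forall>t\<in>S. f (- t) = f t)"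

text \<open>Power series expansions are taken relative to \<open>S\<close>, so that values outside \<open>S\<close> play no role;
  on a nondegenerate compact interval this is the same as having a real analytic extension to a
  neighbourhood.\<close>

definition real_analytic_on :: "real set \<Rightarrow> (real \<Rightarrow> real) \<Rightarrow> bool" where
  "real_analytic_on S f \<longleftrightarrow>
     (\<forall>x\<in>S. \<exists>r>0. \<exists>a :: nat \<Rightarrow> real. \<forall>y\<in>S. \<bar>y - x\<bar> < r \<longrightarrow> (\<lambda>n. a n * (y - x) ^ n) sums f y)"

text \<open>\<open>(\<alpha>)\<^sub>k = \<Gamma>(\<alpha>+1)/\<Gamma>(\<alpha>+1-k)\<close>. At the poles of the denominator (integer \<open>\<alpha> < k\<close>) the library has
  \<open>Gamma = 0\<close>, and \<open>x / 0 = 0\<close> gives the intended value \<open>0\<close>.\<close>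

definition gamma_ratio :: "real \<Rightarrow> nat \<Rightarrow> real" where
  "gamma_ratio \<alpha> k = Gamma (\<alpha> + 1) / Gamma (\<alpha> + 1 - real k)"

text \<open>\<open>D k\<close> is the \<open>k\<close>-th derivative of \<open>B\<close> on \<open>(0,L]\<close>, one-sided at \<open>L\<close>. Whether \<open>c\<close> has to be nonzero
  depends on the role of \<open>K\<close> (autocovariance or cross-covariance), so it is not required here.\<close>

definition condition_A :: "real \<Rightarrow> real \<Rightarrow> real \<Rightarrow> (real \<Rightarrow> real) \<Rightarrow> bool" where
  "condition_A L c \<alpha> K \<longleftrightarrow>
     \<alpha> > 0 \<and> (\<forall>j::nat. \<alpha> \<noteq> 2 * real j) \<and>
     (\<exists>A B. (\<forall>t\<in>{-L..L}. K t = A t + B t) \<and>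
        even_on {-L..L} A \<and> real_analytic_on {-L..L} A \<and>
        even_on {-L..L} B \<and> continuous_on {-L..L} B \<and>
        (\<exists>D :: nat \<Rightarrow> real \<Rightarrow> real.
           (\<forall>t\<in>{0<..L}. D 0 t = B t) \<and>
           (\<forall>k. \<forall>t\<in>{0<..L}. (D k has_real_derivative D (Suc k) t) (at t within {0<..L})) \<and>
           (\<forall>k. (\<lambda>t. D k t - gamma_ratio \<alpha> k * c * t powr (\<alpha> - real k))
                  \<in> o[at_right 0](\<lambda>t. t powr (\<alpha> - real k)))))"

text \<open>Normal laws include the degenerate ones (\<open>\<sigma> = 0\<close>, point masses), as is needed to speak of
  arbitrary linear combinations of jointly Gaussian variables.\<close>

definition normal_rv :: "'w measure \<Rightarrow> ('w \<Rightarrow> real) \<Rightarrow> bool" where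
  "normal_rv M U \<longleftrightarrow> U \<in> borel_measurable M \<and>
     (\<exists>\<mu> \<sigma>. \<sigma> \<ge> 0 \<and>
        distr M borel U =
          (if \<sigma> = 0 then return borel \<mu> else density lborel (\<lambda>x. ennreal (normal_density \<mu> \<sigma> x))))"

definition gaussian_field :: "'w measure \<Rightarrow> (real \<Rightarrow> 'w \<Rightarrow> real ^ 'k) \<Rightarrow> bool" where
  "gaussian_field M Z \<longleftrightarrow>
     (\<forall>F a. finite F \<longrightarrow> normal_rv M (\<lambda>\<omega>. \<Sum>s\<in>F. a s \<bullet> Z s \<omega>))"

definition cov :: "'w measure \<Rightarrow> ('w \<Rightarrow> real) \<Rightarrow> ('w \<Rightarrow> real) \<Rightarrow> real" where
  "cov M U V = integral\<^sup>L M (\<lambda>\<omega>. (U \<omega> - integral\<^sup>L M U) * (V \<omega> - integral\<^sup>L M V))"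

text \<open>The constant mean is not assumed to vanish.\<close>

definition stationary_gaussian_field ::
    "'w measure \<Rightarrow> (real \<Rightarrow> 'w \<Rightarrow> real ^ 'k) \<Rightarrow> (real \<Rightarrow> real ^ 'k ^ 'k) \<Rightarrow> bool" where
  "stationary_gaussian_field M Z K \<longleftrightarrow>
     prob_space M \<and> gaussian_field M Z \<and>
     (\<exists>\<mu> :: real ^ 'k. \<forall>s k. integral\<^sup>L M (\<lambda>\<omega>. Z s \<omega> $ k) = \<mu> $ k) \<and>
     (\<forall>s t k l. cov M (\<lambda>\<omega>. Z (s + t) \<omega> $ k) (\<lambda>\<omega>. Z s \<omega> $ l) = K t $ k $ l)"

definition tendsto_in_prob :: "'w measure \<Rightarrow> (nat \<Rightarrow> 'w \<Rightarrow> real) \<Rightarrow> real \<Rightarrow> bool" where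
  "tendsto_in_prob M U u \<longleftrightarrow>
     (\<forall>\<epsilon>>0. (\<lambda>n. measure M {\<omega> \<in> space M. \<bar>U n \<omega> - u\<bar> > \<epsilon>}) \<longlonglongrightarrow> 0)"

definition spacing :: "(nat \<Rightarrow> real) \<Rightarrow> nat \<Rightarrow> real" where
  "spacing s i = s (i + 1) - s i"

definition mean_spacing :: "(nat \<Rightarrow> real) \<Rightarrow> nat \<Rightarrow> real" where
  "mean_spacing s i = (spacing s (i - 1) + spacing s i) / 2"

definition second_difference :: "(nat \<Rightarrow> real) \<Rightarrow> (real \<Rightarrow> real) \<Rightarrow> nat \<Rightarrow> real" where
  "second_difference s x i =
     inverse (mean_spacing s i) *
       ((x (s (i + 1)) - x (s i)) / spacing s i - (x (s i) - x (s (i - 1))) / spacing s (i - 1))"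

definition OLS :: "nat \<Rightarrow> (nat \<Rightarrow> real) \<Rightarrow> (nat \<Rightarrow> real) \<Rightarrow> real" where
  "OLS n u v = (\<Sum>i=1..n-1. u i * v i) / (\<Sum>i=1..n-1. (u i)\<^sup>2)"

end

theory Submission
  imports Defs
begin

text \<open>With \<open>u\<^sub>i = (\<Delta>X)\<^sub>i\<close> and \<open>w\<^sub>i = (\<Delta>W)\<^sub>i\<close>, the estimation error is \<open>N/D\<close> with \<open>N = \<Sum> u\<^sub>i w\<^sub>i\<close> and
  \<open>D = \<Sum> u\<^sub>i\<^sup>2\<close>. The covariance of two second differences is the double second difference of the
  covariance function \<open>K\<close>. Away from the diagonal it equals the fourth derivative of \<open>K\<close> at an
  intermediate point; near the diagonal only the terms \<open>c |t|\<^sup>\<alpha>\<close> and \<open>O(t\<^sup>4)\<close> of \<open>K\<close> survive. Hence the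
  covariances are at most of order \<open>(n / (1 + |i - j|))\<^sup>p\<close> with \<open>p = max (4 - \<alpha>) 0\<close>, whereas \<open>E u\<^sub>i\<^sup>2\<close> is at
  least of order \<open>n\<close> to the power \<open>4 - \<alpha>\<^sub>1\<^sub>1\<close>, because \<open>(x + y)\<^sup>q\<close> differs from \<open>x\<^sup>q + y\<^sup>q\<close> for
  \<open>q = \<alpha>\<^sub>1\<^sub>1 - 1 \<noteq> 1\<close>. Isserlis' formula, which follows from \<open>E G\<^sup>4 = 3 (E G\<^sup>2)\<^sup>2\<close> by polarization, turns
  these bounds into \<open>Var D = o((E D)\<^sup>2)\<close> and \<open>E N\<^sup>2 = o((E D)\<^sup>2)\<close>, and Chebyshev's inequality
  concludes.\<close>

section \<open>Moments of jointly normal variables\<close>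

text \<open>Write \<open>p11\<close>, \<open>p12\<close>, \<open>p22\<close> for the values of max
  (4 - \<alpha>) 0 belonging to the three covariances. As E D is at least of order n^(1+p11),
  everything is measured against n^(2+2 p11). In E N^2, two of the three Isserlis pairings involve
  only covariances between u and w. They are of order n^(2+2 p12) even if decay in |i - j| is
  ignored, and \<alpha>11 < \<alpha>12 makes this negligible. The third multiplies covariances of u
  by covariances of w. Without decay it would be bounded only by n^(2+p11+p22), too much once p22
  \<ge> p11; with decay it is n^(1+p11+p22) times the sum of k^(-p11-p22), and here \<alpha>22 >
  \<alpha>11 - 1 enters. The obstacle is the irregular grid, which changes with n: the covariances
  are not functions of i - j, and the rescaled ones need not converge. Every estimate must therefore
  hold with constants common to all grids with the same L, m and M. For the lower bound this comes
  from compactness of the set of rescaled spacings.\<close>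

lemma normal_rv_moments:
  fixes U :: "'w \<Rightarrow> real"
  assumes "prob_space M" and U: "normal_rv M U"
  shows integrable_normal_rv_central_moment:
      "integrable M (\<lambda>\<omega>. (U \<omega> - integral\<^sup>L M U) ^ k)"
    and normal_rv_fourth_central_moment:
      "(\<integral>\<omega>. (U \<omega> - integral\<^sup>L M U) ^ 4 \<partial>M) = 3 * (\<integral>\<omega>. (U \<omega> - integral\<^sup>L M U)\<^sup>2 \<partial>M)\<^sup>2"
proof -
  interpret prob_space M by fact
  from U obtain \<mu> \<sigma> where [measurable]: "U \<in> borel_measurable M" and "\<sigma> \<ge> 0" and
    d: "distr M borel U = (if \<sigma> = 0 then return borel \<mu>
      else density lborel (\<lambda>x. ennreal (normal_density \<mu> \<sigma> x)))"
    unfolding normal_rv_def by blast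
  have "integrable M (\<lambda>\<omega>. (U \<omega> - integral\<^sup>L M U) ^ k) \<and>
    (\<integral>\<omega>. (U \<omega> - integral\<^sup>L M U) ^ 4 \<partial>M) = 3 * (\<integral>\<omega>. (U \<omega> - integral\<^sup>L M U)\<^sup>2 \<partial>M)\<^sup>2"
  proof (cases "\<sigma> = 0")
    case True
    \<comment> \<open>A point mass has no density, so the degenerate case goes through almost sure
      equality; \<open>0 ^ 0 = 1\<close> causes the case distinction in \<open>ae'\<close>.\<close>
    have "AE x in distr M borel U. x = \<mu>"
      unfolding d using True by (simp, subst AE_return) auto
    hence ae: "AE \<omega> in M. U \<omega> = \<mu>"
      by (rule AE_distrD[rotated]) simp
    have "integral\<^sup>L M U = (\<integral>\<omega>. \<mu> \<partial>M)"
      by (rule integral_cong_AE) (use ae in auto)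
    hence EU: "integral\<^sup>L M U = \<mu>" by (simp add: prob_space)
    have ae': "AE \<omega> in M. (U \<omega> - integral\<^sup>L M U) ^ j = (if j = 0 then 1 else 0)" for j
      using ae by eventually_elim (simp add: EU)
    have "integrable M (\<lambda>\<omega>. (U \<omega> - integral\<^sup>L M U) ^ k) \<longleftrightarrow> integrable M (\<lambda>\<omega>. (if k = 0 then 1 else 0::real))"
      by (rule integrable_cong_AE) (use ae' in auto)
    moreover have "(\<integral>\<omega>. (U \<omega> - integral\<^sup>L M U) ^ j \<partial>M) = (\<integral>\<omega>. (if j = 0 then 1 else 0) \<partial>M)" for j
      by (rule integral_cong_AE) (use ae' in auto)
    ultimately show ?thesis by simp
  next
    case False
    hence \<sigma>: "\<sigma> > 0" using \<open>\<sigma> \<ge> 0\<close> by simp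
    have D: "distributed M lborel U (\<lambda>x. ennreal (normal_density \<mu> \<sigma> x))"
      using d False unfolding distributed_def by (simp add: cong: distr_cong)
    have EU: "integral\<^sup>L M U = \<mu>"
      using normal_distributed_expectation[OF \<sigma> D] by simp
    have int: "integrable M (\<lambda>\<omega>. (U \<omega> - \<mu>) ^ j)" for j
      using distributed_integrable[OF D, of "\<lambda>x. (x - \<mu>) ^ j"] integrable_normal_moment[OF \<sigma>, of \<mu> j]
      by simp
    have eq: "(\<integral>\<omega>. (U \<omega> - \<mu>) ^ j \<partial>M) = (\<integral>x. normal_density \<mu> \<sigma> x * (x - \<mu>) ^ j \<partial>lborel)" for j
      using distributed_integral[OF D, of "\<lambda>x. (x - \<mu>) ^ j"] by simp
    have 2: "(\<integral>\<omega>. (U \<omega> - \<mu>) ^ 2 \<partial>M) = \<sigma>\<^sup>2"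
      using integral_normal_moment_even[OF \<sigma>, of \<mu> 1] by (simp add: eq fact_numeral)
    \<comment> \<open>The moment of order 2k is (2k)! / (2^k k!) times \<sigma>^(2k); at k = 2 the
      factor is 24 / 8 = 3.\<close>
    have 4: "(\<integral>\<omega>. (U \<omega> - \<mu>) ^ 4 \<partial>M) = 3 * \<sigma> ^ 4"
      using integral_normal_moment_even[OF \<sigma>, of \<mu> 2] \<sigma>
      by (simp add: eq fact_numeral field_simps flip: power_mult)
    show ?thesis unfolding EU using int 2 4 by (simp flip: power_mult)
  qed
  thus "integrable M (\<lambda>\<omega>. (U \<omega> - integral\<^sup>L M U) ^ k)"
    "(\<integral>\<omega>. (U \<omega> - integral\<^sup>L M U) ^ 4 \<partial>M) = 3 * (\<integral>\<omega>. (U \<omega> - integral\<^sup>L M U)\<^sup>2 \<partial>M)\<^sup>2"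
    by auto
qed

text \<open>Joint normality enters only as a linear space of normal variables. Polarization asks for
  nothing but moments of sums and differences, so joint densities, which degenerate covariances
  would exclude, are avoided.\<close>

locale centered_gaussian_space = prob_space M for M :: "'w measure" +
  fixes H :: "('w \<Rightarrow> real) set"
  assumes add: "U \<in> H \<Longrightarrow> V \<in> H \<Longrightarrow> (\<lambda>\<omega>. U \<omega> + V \<omega>) \<in> H"
    and scale: "U \<in> H \<Longrightarrow> (\<lambda>\<omega>. a * U \<omega>) \<in> H"
    and normal: "U \<in> H \<Longrightarrow> normal_rv M U"
    and centered: "U \<in> H \<Longrightarrow> expectation U = 0"
begin

lemma diff: "U \<in> H \<Longrightarrow> V \<in> H \<Longrightarrow> (\<lambda>\<omega>. U \<omega> - V \<omega>) \<in> H"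
  using add[of U "\<lambda>\<omega>. - 1 * V \<omega>"] scale[of V "- 1"] by simp

lemma measurable: "U \<in> H \<Longrightarrow> U \<in> borel_measurable M"
  using normal unfolding normal_rv_def by blast

lemma integrable_power: "U \<in> H \<Longrightarrow> integrable M (\<lambda>\<omega>. U \<omega> ^ k)"
  using integrable_normal_rv_central_moment[OF prob_space_axioms normal, of U k]
  by (simp add: centered)

lemma fourth_moment: "U \<in> H \<Longrightarrow> expectation (\<lambda>\<omega>. U \<omega> ^ 4) = 3 * (expectation (\<lambda>\<omega>. (U \<omega>)\<^sup>2))\<^sup>2"
  using normal_rv_fourth_central_moment[OF prob_space_axioms normal, of U]
  by (simp add: centered)

section \<open>Polarization, from fourth moments to Isserlis' formula\<close>

lemma integrable_product:
  assumes "U \<in> H" "V \<in> H"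
  shows "integrable M (\<lambda>\<omega>. U \<omega> * V \<omega>)"
proof -
  have eq: "(\<lambda>\<omega>. U \<omega> * V \<omega>) = (\<lambda>\<omega>. ((U \<omega> + V \<omega>)\<^sup>2 - (U \<omega> - V \<omega>)\<^sup>2) / 4)"
    by (rule ext) (simp add: power2_eq_square algebra_simps)
  show ?thesis
    unfolding eq using integrable_power[OF add[OF assms], of 2] integrable_power[OF diff[OF assms], of 2] by auto
qed

lemma second_moment_add:
  assumes "U \<in> H" "V \<in> H"
  shows "expectation (\<lambda>\<omega>. (U \<omega> + V \<omega>)\<^sup>2) =
      expectation (\<lambda>\<omega>. (U \<omega>)\<^sup>2) + 2 * expectation (\<lambda>\<omega>. U \<omega> * V \<omega>) + expectation (\<lambda>\<omega>. (V \<omega>)\<^sup>2)"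
proof -
  have "(\<lambda>\<omega>. (U \<omega> + V \<omega>)\<^sup>2) = (\<lambda>\<omega>. (U \<omega>)\<^sup>2 + 2 * (U \<omega> * V \<omega>) + (V \<omega>)\<^sup>2)"
    by (rule ext) (simp add: power2_eq_square algebra_simps)
  thus ?thesis
    using integrable_power[OF assms(1), of 2] integrable_power[OF assms(2), of 2]
      integrable_product[OF assms] by simp
qed

lemma second_moment_diff:
  assumes "U \<in> H" "V \<in> H"
  shows "expectation (\<lambda>\<omega>. (U \<omega> - V \<omega>)\<^sup>2) =
      expectation (\<lambda>\<omega>. (U \<omega>)\<^sup>2) - 2 * expectation (\<lambda>\<omega>. U \<omega> * V \<omega>) + expectation (\<lambda>\<omega>. (V \<omega>)\<^sup>2)"
proof -
  have "(\<lambda>\<omega>. (U \<omega> - V \<omega>)\<^sup>2) = (\<lambda>\<omega>. (U \<omega>)\<^sup>2 - 2 * (U \<omega> * V \<omega>) + (V \<omega>)\<^sup>2)"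
    by (rule ext) (simp add: power2_eq_square algebra_simps)
  thus ?thesis
    using integrable_power[OF assms(1), of 2] integrable_power[OF assms(2), of 2]
      integrable_product[OF assms] by simp
qed

text \<open>In (U + V)^4 + (U - V)^4 the odd mixed terms cancel, leaving 12 U^2 V^2 beside pure
  fourth powers; each fourth moment is then three times a squared second moment.\<close>

lemma square_square:
  assumes "U \<in> H" "V \<in> H"
  shows integrable_square_square: "integrable M (\<lambda>\<omega>. (U \<omega>)\<^sup>2 * (V \<omega>)\<^sup>2)"
    and expectation_square_square: "expectation (\<lambda>\<omega>. (U \<omega>)\<^sup>2 * (V \<omega>)\<^sup>2) =
      expectation (\<lambda>\<omega>. (U \<omega>)\<^sup>2) * expectation (\<lambda>\<omega>. (V \<omega>)\<^sup>2) + 2 * (expectation (\<lambda>\<omega>. U \<omega> * V \<omega>))\<^sup>2"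
proof -
  have eq: "(\<lambda>\<omega>. (U \<omega>)\<^sup>2 * (V \<omega>)\<^sup>2) =
    (\<lambda>\<omega>. ((U \<omega> + V \<omega>) ^ 4 + (U \<omega> - V \<omega>) ^ 4 - 2 * U \<omega> ^ 4 - 2 * V \<omega> ^ 4) / 12)"
    by (rule ext) (simp add: power2_eq_square power4_eq_xxxx algebra_simps)
  note i = integrable_power[OF add[OF assms], of 4] integrable_power[OF diff[OF assms], of 4]
    integrable_power[OF assms(1), of 4] integrable_power[OF assms(2), of 4]
  show "integrable M (\<lambda>\<omega>. (U \<omega>)\<^sup>2 * (V \<omega>)\<^sup>2)" unfolding eq using i by auto
  have "expectation (\<lambda>\<omega>. (U \<omega>)\<^sup>2 * (V \<omega>)\<^sup>2) =
    (expectation (\<lambda>\<omega>. (U \<omega> + V \<omega>) ^ 4) + expectation (\<lambda>\<omega>. (U \<omega> - V \<omega>) ^ 4)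
     - 2 * expectation (\<lambda>\<omega>. U \<omega> ^ 4) - 2 * expectation (\<lambda>\<omega>. V \<omega> ^ 4)) / 12"
    unfolding eq using i by simp
  thus "expectation (\<lambda>\<omega>. (U \<omega>)\<^sup>2 * (V \<omega>)\<^sup>2) =
      expectation (\<lambda>\<omega>. (U \<omega>)\<^sup>2) * expectation (\<lambda>\<omega>. (V \<omega>)\<^sup>2) + 2 * (expectation (\<lambda>\<omega>. U \<omega> * V \<omega>))\<^sup>2"
    unfolding fourth_moment[OF add[OF assms]] fourth_moment[OF diff[OF assms]]
      fourth_moment[OF assms(1)] fourth_moment[OF assms(2)]
      second_moment_add[OF assms] second_moment_diff[OF assms]
    by (simp add: power2_eq_square algebra_simps)
qed

lemma product_add:
  assumes "U \<in> H" "V \<in> H" "S \<in> H"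
  shows "expectation (\<lambda>\<omega>. (U \<omega> + V \<omega>) * S \<omega>) = expectation (\<lambda>\<omega>. U \<omega> * S \<omega>) + expectation (\<lambda>\<omega>. V \<omega> * S \<omega>)"
    and "expectation (\<lambda>\<omega>. (U \<omega> - V \<omega>) * S \<omega>) = expectation (\<lambda>\<omega>. U \<omega> * S \<omega>) - expectation (\<lambda>\<omega>. V \<omega> * S \<omega>)"
    and "expectation (\<lambda>\<omega>. S \<omega> * (U \<omega> + V \<omega>)) = expectation (\<lambda>\<omega>. S \<omega> * U \<omega>) + expectation (\<lambda>\<omega>. S \<omega> * V \<omega>)"
    and "expectation (\<lambda>\<omega>. S \<omega> * (U \<omega> - V \<omega>)) = expectation (\<lambda>\<omega>. S \<omega> * U \<omega>) - expectation (\<lambda>\<omega>. S \<omega> * V \<omega>)"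
  using integrable_product[OF assms(1,3)] integrable_product[OF assms(2,3)]
    integrable_product[OF assms(3,1)] integrable_product[OF assms(3,2)]
  by (simp_all add: algebra_simps)

text \<open>Both 4 U V and 4 S T are differences of squares, so 16 U V S T is a signed sum of four
  products of two squares. The bracketing is that of a product of two summands
  \<open>u i * w i\<close> and \<open>u j * w j\<close>.\<close>

lemma isserlis:
  assumes "U \<in> H" "V \<in> H" "S \<in> H" "T \<in> H"
  shows integrable_product4: "integrable M (\<lambda>\<omega>. U \<omega> * V \<omega> * (S \<omega> * T \<omega>))"
    and expectation_product4: "expectation (\<lambda>\<omega>. U \<omega> * V \<omega> * (S \<omega> * T \<omega>)) =
      expectation (\<lambda>\<omega>. U \<omega> * V \<omega>) * expectation (\<lambda>\<omega>. S \<omega> * T \<omega>) +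
      expectation (\<lambda>\<omega>. U \<omega> * S \<omega>) * expectation (\<lambda>\<omega>. V \<omega> * T \<omega>) +
      expectation (\<lambda>\<omega>. U \<omega> * T \<omega>) * expectation (\<lambda>\<omega>. V \<omega> * S \<omega>)"
proof -
  have eq: "(\<lambda>\<omega>. U \<omega> * V \<omega> * (S \<omega> * T \<omega>)) =
    (\<lambda>\<omega>. ((U \<omega> + V \<omega>)\<^sup>2 * (S \<omega> + T \<omega>)\<^sup>2 - (U \<omega> + V \<omega>)\<^sup>2 * (S \<omega> - T \<omega>)\<^sup>2
       - (U \<omega> - V \<omega>)\<^sup>2 * (S \<omega> + T \<omega>)\<^sup>2 + (U \<omega> - V \<omega>)\<^sup>2 * (S \<omega> - T \<omega>)\<^sup>2) / 16)"
    by (rule ext) (simp add: power2_eq_square algebra_simps)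
  note sq = add[OF assms(1,2)] diff[OF assms(1,2)] add[OF assms(3,4)] diff[OF assms(3,4)]
  note i = integrable_square_square[OF sq(1) sq(3)] integrable_square_square[OF sq(1) sq(4)]
    integrable_square_square[OF sq(2) sq(3)] integrable_square_square[OF sq(2) sq(4)]
  note e = expectation_square_square[OF sq(1) sq(3)] expectation_square_square[OF sq(1) sq(4)]
    expectation_square_square[OF sq(2) sq(3)] expectation_square_square[OF sq(2) sq(4)]
  show "integrable M (\<lambda>\<omega>. U \<omega> * V \<omega> * (S \<omega> * T \<omega>))" unfolding eq using i by auto
  have "expectation (\<lambda>\<omega>. U \<omega> * V \<omega> * (S \<omega> * T \<omega>)) =
    (expectation (\<lambda>\<omega>. (U \<omega> + V \<omega>)\<^sup>2 * (S \<omega> + T \<omega>)\<^sup>2) - expectation (\<lambda>\<omega>. (U \<omega> + V \<omega>)\<^sup>2 * (S \<omega> - T \<omega>)\<^sup>2)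
       - expectation (\<lambda>\<omega>. (U \<omega> - V \<omega>)\<^sup>2 * (S \<omega> + T \<omega>)\<^sup>2) + expectation (\<lambda>\<omega>. (U \<omega> - V \<omega>)\<^sup>2 * (S \<omega> - T \<omega>)\<^sup>2)) / 16"
    unfolding eq using i by simp
  thus "expectation (\<lambda>\<omega>. U \<omega> * V \<omega> * (S \<omega> * T \<omega>)) =
      expectation (\<lambda>\<omega>. U \<omega> * V \<omega>) * expectation (\<lambda>\<omega>. S \<omega> * T \<omega>) +
      expectation (\<lambda>\<omega>. U \<omega> * S \<omega>) * expectation (\<lambda>\<omega>. V \<omega> * T \<omega>) +
      expectation (\<lambda>\<omega>. U \<omega> * T \<omega>) * expectation (\<lambda>\<omega>. V \<omega> * S \<omega>)"
    unfolding e second_moment_add[OF assms(1,2)] second_moment_diff[OF assms(1,2)]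
      second_moment_add[OF assms(3,4)] second_moment_diff[OF assms(3,4)]
      product_add(1)[OF assms(1,2) sq(3)] product_add(1)[OF assms(1,2) sq(4)]
      product_add(2)[OF assms(1,2) sq(3)] product_add(2)[OF assms(1,2) sq(4)]
      product_add(3)[OF assms(3,4,1)] product_add(3)[OF assms(3,4,2)]
      product_add(4)[OF assms(3,4,1)] product_add(4)[OF assms(3,4,2)]
    by (simp add: power2_eq_square algebra_simps)
qed

end

section \<open>Sums of powers\<close>

text \<open>Comparison with the integral of x^(-\<theta>), one unit step at a time through the mean
  value theorem for its antiderivative.\<close>

lemma sum_powr_le:
  assumes "0 < \<theta>" "\<theta> < 1"
  shows "(\<Sum>k=1..n. real k powr (-\<theta>)) \<le> real n powr (1 - \<theta>) / (1 - \<theta>)"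
proof (induction n)
  case (Suc n)
  have "\<exists>z>real n. z < real (Suc n) \<and>
      real (Suc n) powr (1 - \<theta>) / (1 - \<theta>) - real n powr (1 - \<theta>) / (1 - \<theta>) = (real (Suc n) - real n) * z powr (-\<theta>)"
    if "n > 0"
  proof (rule MVT2)
    fix x assume "real n \<le> x" "x \<le> real (Suc n)"
    hence "x > 0" using that by linarith
    thus "((\<lambda>x. x powr (1 - \<theta>) / (1 - \<theta>)) has_real_derivative x powr (-\<theta>)) (at x)"
      using DERIV_cdivide[OF has_real_derivative_powr[of x "1 - \<theta>"], of "1 - \<theta>"] assms by simp
  qed simp
  hence "real (Suc n) powr (-\<theta>) \<le> real (Suc n) powr (1 - \<theta>) / (1 - \<theta>) - real n powr (1 - \<theta>) / (1 - \<theta>)"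
  \<comment> \<open>The antiderivative is not differentiable at 0, so the first step is separate:
    there the claim is 1 \<le> 1 / (1 - \<theta>), by
    \<open>0 powr (1 - \<theta>) = 0\<close>.\<close>
  proof (cases "n = 0")
    case False
    with \<open>n > 0 \<Longrightarrow> _\<close> obtain z where z: "z > real n" "z < real (Suc n)"
      "real (Suc n) powr (1 - \<theta>) / (1 - \<theta>) - real n powr (1 - \<theta>) / (1 - \<theta>) = z powr (-\<theta>)"
      by auto
    have "real (Suc n) powr (-\<theta>) \<le> z powr (-\<theta>)"
      by (rule powr_mono2') (use z assms in auto)
    thus ?thesis using z by simp
  qed (use assms in \<open>simp add: field_simps\<close>)
  with Suc show ?case by simp
qed simp

text \<open>The sum is bounded, logarithmic or of order n^(1-q), depending on q. Lowering q to some
  \<theta> < 1 with \<theta> > 1 - d treats the three regimes at once; q + d > 1 leaves room for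
  such a \<theta>.\<close>

lemma powr_times_sum_powr_tendsto_0:
  assumes "q > 0" "d > 0" "q + d > 1"
  shows "(\<lambda>n. real n powr (-d) * (\<Sum>k=1..n. real k powr (-q))) \<longlonglongrightarrow> 0"
proof -
  obtain \<theta> where \<theta>: "max 0 (1 - d) < \<theta>" "\<theta> < min q 1"
    using dense[of "max 0 (1 - d)" "min q 1"] assms by auto
  have "eventually (\<lambda>n. norm (real n powr (-d) * (\<Sum>k=1..n. real k powr (-q))) \<le> real n powr (1 - \<theta> - d) / (1 - \<theta>)) sequentially"
  proof (intro always_eventually allI)
    fix n
    have "(\<Sum>k=1..n. real k powr (-q)) \<le> (\<Sum>k=1..n. real k powr (-\<theta>))"
      by (intro sum_mono powr_mono) (use \<theta> in auto)
    also have "\<dots> \<le> real n powr (1 - \<theta>) / (1 - \<theta>)"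
      by (rule sum_powr_le) (use \<theta> in auto)
    finally have "real n powr (-d) * (\<Sum>k=1..n. real k powr (-q)) \<le> real n powr (-d) * (real n powr (1 - \<theta>) / (1 - \<theta>))"
      by (rule mult_left_mono) simp
    also have "\<dots> = real n powr (1 - \<theta> - d) / (1 - \<theta>)"
      by (simp add: algebra_simps flip: powr_add)
    finally show "norm (real n powr (-d) * (\<Sum>k=1..n. real k powr (-q))) \<le> real n powr (1 - \<theta> - d) / (1 - \<theta>)"
      by (simp add: sum_nonneg)
  qed
  moreover have "(\<lambda>n. real n powr (1 - \<theta> - d) / (1 - \<theta>)) \<longlonglongrightarrow> 0"
    by (intro tendsto_divide_zero tendsto_neg_powr filterlim_real_sequentially) (use \<theta> in auto)
  ultimately show ?thesis by (rule Lim_null_comparison)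
qed


text \<open>The two truncated differences add up to |i - j|. For fixed i each value of it comes from
  at most one j on either side, so a row costs at most twice the simple sum.\<close>

lemma double_sum_gap_le:
  fixes g :: "nat \<Rightarrow> real"
  assumes "\<And>k. g k \<ge> 0"
  shows "(\<Sum>i=1..N. \<Sum>j=1..N. g (1 + (i - j) + (j - i))) \<le> 2 * real N * (\<Sum>k=1..N. g k)"
proof -
  have "(\<Sum>j=1..N. g (1 + (i - j) + (j - i))) \<le> 2 * (\<Sum>k=1..N. g k)" if i: "i \<in> {1..N}" for i
  proof -
    have "(\<Sum>j=1..N. g (1 + (i - j) + (j - i))) =
        (\<Sum>j\<in>{1..i}. g (1 + (i - j) + (j - i))) + (\<Sum>j\<in>{i<..N}. g (1 + (i - j) + (j - i)))"
      using i by (subst sum.union_disjoint[symmetric]) (auto intro!: sum.cong)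
    also have "(\<Sum>j\<in>{1..i}. g (1 + (i - j) + (j - i))) = (\<Sum>j\<in>{1..i}. g (1 + (i - j)))"
      by (intro sum.cong) auto
    also have "\<dots> = (\<Sum>k\<in>(\<lambda>j. 1 + (i - j)) ` {1..i}. g k)"
      by (subst sum.reindex) (auto simp: inj_on_def)
    also have "\<dots> \<le> (\<Sum>k=1..N. g k)"
      by (intro sum_mono2) (use i assms in auto)
    also have "(\<Sum>j\<in>{i<..N}. g (1 + (i - j) + (j - i))) = (\<Sum>j\<in>{i<..N}. g (1 + (j - i)))"
      by (intro sum.cong) auto
    also have "\<dots> = (\<Sum>k\<in>(\<lambda>j. 1 + (j - i)) ` {i<..N}. g k)"
      by (subst sum.reindex) (auto simp: inj_on_def)
    also have "\<dots> \<le> (\<Sum>k=1..N. g k)"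
      by (intro sum_mono2) (use i assms in auto)
    finally show ?thesis by simp
  qed
  hence "(\<Sum>i=1..N. \<Sum>j=1..N. g (1 + (i - j) + (j - i))) \<le> (\<Sum>i=1..N. 2 * (\<Sum>k=1..N. g k))"
    by (rule sum_mono)
  thus ?thesis by (simp add: mult_ac)
qed

section \<open>Even analytic functions\<close>

text \<open>Expansions about the end points of the interval are included, so that derivatives stay bounded
  up to the boundary.\<close>

definition locally_power_series :: "real \<Rightarrow> (real \<Rightarrow> real) \<Rightarrow> bool" where
  "locally_power_series L f \<longleftrightarrow>
     (\<forall>x\<in>{-L..L}. \<exists>r>0. \<exists>a :: nat \<Rightarrow> real.
        (\<forall>z. \<bar>z\<bar> < r \<longrightarrow> summable (\<lambda>n. a n * z ^ n)) \<and>
        (\<forall>y\<in>{-L<..<L}. \<bar>y - x\<bar> < r \<longrightarrow> f y = (\<Sum>n. a n * (y - x) ^ n)))"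

text \<open>Analyticity on the interval grants convergence at points of the interval only, hence on
  one side at an end point. Convergence at a single point at distance q already implies it for all
  |z| < q.\<close>

lemma real_analytic_on_interval_power_series:
  assumes "L > 0" "real_analytic_on {-L..L} f" "x \<in> {-L..L}"
  obtains r and a :: "nat \<Rightarrow> real" where "r > 0"
    and "\<And>z. \<bar>z\<bar> < r \<Longrightarrow> summable (\<lambda>n. a n * z ^ n)"
    and "\<And>y. y \<in> {-L..L} \<Longrightarrow> \<bar>y - x\<bar> < r \<Longrightarrow> f y = (\<Sum>n. a n * (y - x) ^ n)"
proof -
  obtain r a where r: "r > 0" and a: "\<And>y. y \<in> {-L..L} \<Longrightarrow> \<bar>y - x\<bar> < r \<Longrightarrow> (\<lambda>n. a n * (y - x) ^ n) sums f y"
    using assms(2,3) unfolding real_analytic_on_def by metis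
  define q where "q = min r L / 2"
  have q: "q > 0" "q < r" "q < L" using r assms(1) unfolding q_def by (auto simp: min_def)
  \<comment> \<open>A step of length q < L in the direction of the origin stays in the interval,
    even from an end point.\<close>
  define y0 where "y0 = (if x \<ge> 0 then x - q else x + q)"
  have y0: "y0 \<in> {-L..L}" "\<bar>y0 - x\<bar> = q" "\<bar>y0 - x\<bar> < r"
    using q assms(3) unfolding y0_def by auto
  have "summable (\<lambda>n. a n * (y0 - x) ^ n)"
    using a[OF y0(1,3)] by (simp add: sums_iff)
  hence "summable (\<lambda>n. a n * z ^ n)" if "\<bar>z\<bar> < q" for z
    using powser_inside[of a "y0 - x" z] y0 that by simp
  moreover have "f y = (\<Sum>n. a n * (y - x) ^ n)" if "y \<in> {-L..L}" "\<bar>y - x\<bar> < q" for y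
    using a[of y] that q by (simp add: sums_iff)
  ultimately show ?thesis using q(1) by (rule that[rotated])
qed

lemma locally_power_series_if_real_analytic_on:
  assumes "L > 0" "real_analytic_on {-L..L} f"
  shows "locally_power_series L f"
  unfolding locally_power_series_def
proof
  fix x assume "x \<in> {-L..L}"
  from real_analytic_on_interval_power_series[OF assms this]
  obtain r a where "r > 0" "\<And>z. \<bar>z\<bar> < r \<Longrightarrow> summable (\<lambda>n. a n * z ^ n)"
    "\<And>y. y \<in> {-L..L} \<Longrightarrow> \<bar>y - x\<bar> < r \<Longrightarrow> f y = (\<Sum>n. a n * (y - x) ^ n)" by metis
  thus "\<exists>r>0. \<exists>a :: nat \<Rightarrow> real.
        (\<forall>z. \<bar>z\<bar> < r \<longrightarrow> summable (\<lambda>n. a n * z ^ n)) \<and>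
        (\<forall>y\<in>{-L<..<L}. \<bar>y - x\<bar> < r \<longrightarrow> f y = (\<Sum>n. a n * (y - x) ^ n))"
    by (intro exI[of _ r] exI[of _ a]) auto
qed

text \<open>Continuity up to the boundary matters because the first and last node differ by exactly
  L, where the derivatives used later are no longer available.\<close>

lemma continuous_on_real_analytic_on:
  assumes "L > 0" "real_analytic_on {-L..L} f"
  shows "continuous_on {-L..L} f"
  unfolding continuous_on_eq_continuous_within
proof
  fix x assume x: "x \<in> {-L..L}"
  from real_analytic_on_interval_power_series[OF assms this]
  obtain r a where r: "r > 0" and s: "\<And>z. \<bar>z\<bar> < r \<Longrightarrow> summable (\<lambda>n. a n * z ^ n)"
    and f: "\<And>y. y \<in> {-L..L} \<Longrightarrow> \<bar>y - x\<bar> < r \<Longrightarrow> f y = (\<Sum>n. a n * (y - x) ^ n)" by metis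
  have "isCont (\<lambda>z. \<Sum>n. a n * z ^ n) (x - x)"
    by (rule DERIV_isCont[OF termdiffs_strong'[of r a]]) (use s r in auto)
  hence "isCont (\<lambda>y. \<Sum>n. a n * (y - x) ^ n) x"
    by (rule isCont_o2[where f = "\<lambda>y. y - x" and g = "\<lambda>z. \<Sum>n. a n * z ^ n", rotated]) simp
  hence "continuous (at x within {-L..L}) (\<lambda>y. \<Sum>n. a n * (y - x) ^ n)"
    by (rule continuous_at_imp_continuous_at_within)
  thus "continuous (at x within {-L..L}) f"
    by (rule continuous_transform_within[OF _ r x]) (use f in \<open>auto simp: dist_real_def\<close>)
qed

text \<open>\<open>deriv\<close> is two-sided and thus controlled only inside the interval. This is
  why the class constrains values on the open interval while expanding about end points too; in this
  form it is closed under differentiation.\<close>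

lemma locally_power_series_deriv:
  assumes "locally_power_series L f"
  shows "\<And>t. t \<in> {-L<..<L} \<Longrightarrow> (f has_real_derivative deriv f t) (at t)"
    and "locally_power_series L (deriv f)"
proof -
  have *: "\<exists>r>0. \<exists>a :: nat \<Rightarrow> real. (\<forall>z. \<bar>z\<bar> < r \<longrightarrow> summable (\<lambda>n. a n * z ^ n)) \<and>
      (\<forall>y\<in>{-L<..<L}. \<bar>y - x\<bar> < r \<longrightarrow> (f has_real_derivative (\<Sum>n. a n * (y - x) ^ n)) (at y))"
    if "x \<in> {-L..L}" for x
  proof -
    obtain r a where r: "r > 0" and s: "\<And>z. \<bar>z\<bar> < r \<Longrightarrow> summable (\<lambda>n. a n * z ^ n)"
      and f: "\<And>y. y \<in> {-L<..<L} \<Longrightarrow> \<bar>y - x\<bar> < r \<Longrightarrow> f y = (\<Sum>n. a n * (y - x) ^ n)"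
      using assms \<open>x \<in> {-L..L}\<close> unfolding locally_power_series_def by metis
    have 1: "summable (\<lambda>n. diffs a n * z ^ n)" if "\<bar>z\<bar> < r" for z
      using termdiff_converges[of z r a] s that by simp
    have 2: "(f has_real_derivative (\<Sum>n. diffs a n * (y - x) ^ n)) (at y)"
      if y: "y \<in> {-L<..<L}" "\<bar>y - x\<bar> < r" for y
    proof -
      have "((\<lambda>z. \<Sum>n. a n * z ^ n) has_real_derivative (\<Sum>n. diffs a n * (y - x) ^ n)) (at (y - x))"
        by (rule termdiffs_strong'[of r]) (use s y in auto)
      hence "((\<lambda>z. \<Sum>n. a n * (z - x) ^ n) has_real_derivative (\<Sum>n. diffs a n * (y - x) ^ n)) (at y)"
        using DERIV_shift[of "\<lambda>z. \<Sum>n. a n * z ^ n" _ y "- x"] by simp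
      moreover have "open ({-L<..<L} \<inter> {x - r<..<x + r})" "y \<in> {-L<..<L} \<inter> {x - r<..<x + r}"
        using y by auto
      ultimately show ?thesis
        by (rule has_field_derivative_transform_within_open) (use f in auto)
    qed
    show ?thesis using r 1 2 by blast
  qed
  show "(f has_real_derivative deriv f t) (at t)" if "t \<in> {-L<..<L}" for t
    using *[of t] that by (force simp: DERIV_deriv_iff_real_differentiable real_differentiable_def)
  show "locally_power_series L (deriv f)"
    unfolding locally_power_series_def
  proof
    fix x assume "x \<in> {-L..L}"
    from *[OF this] show "\<exists>r>0. \<exists>a :: nat \<Rightarrow> real.
        (\<forall>z. \<bar>z\<bar> < r \<longrightarrow> summable (\<lambda>n. a n * z ^ n)) \<and>
        (\<forall>y\<in>{-L<..<L}. \<bar>y - x\<bar> < r \<longrightarrow> deriv f y = (\<Sum>n. a n * (y - x) ^ n))"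
      by (meson DERIV_imp_deriv)
  qed
qed

text \<open>An expansion is bounded on half its disc, and finitely many such discs cover the closed
  interval. The expansions about the end points supply the compactness.\<close>

lemma locally_power_series_bounded:
  assumes "locally_power_series L f"
  obtains C where "\<And>t. t \<in> {-L<..<L} \<Longrightarrow> \<bar>f t\<bar> \<le> C"
proof -
  have "\<exists>r>0. \<exists>C. \<forall>y\<in>{-L<..<L}. \<bar>y - x\<bar> < r \<longrightarrow> \<bar>f y\<bar> \<le> C" if x: "x \<in> {-L..L}" for x
  proof -
    obtain r a where r: "r > 0" and s: "\<And>z. \<bar>z\<bar> < r \<Longrightarrow> summable (\<lambda>n. a n * z ^ n)"
      and f: "\<And>y. y \<in> {-L<..<L} \<Longrightarrow> \<bar>y - x\<bar> < r \<Longrightarrow> f y = (\<Sum>n. a n * (y - x) ^ n)"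
      using assms x unfolding locally_power_series_def by metis
    have "isCont (\<lambda>z. \<Sum>n. a n * z ^ n) z" if "\<bar>z\<bar> < r" for z
      by (rule DERIV_isCont[OF termdiffs_strong'[of r a z]]) (use s that in auto)
    hence "continuous_on {-r/2..r/2} (\<lambda>z. \<Sum>n. a n * z ^ n)"
      using r by (intro continuous_at_imp_continuous_on) auto
    hence "bounded ((\<lambda>z. \<Sum>n. a n * z ^ n) ` {-r/2..r/2})"
      by (intro compact_imp_bounded compact_continuous_image) auto
    then obtain C where C: "\<And>z. z \<in> {-r/2..r/2} \<Longrightarrow> \<bar>\<Sum>n. a n * z ^ n\<bar> \<le> C"
      unfolding bounded_iff real_norm_def by blast
    have "\<forall>y\<in>{-L<..<L}. \<bar>y - x\<bar> < r/2 \<longrightarrow> \<bar>f y\<bar> \<le> C"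
    proof (intro ballI impI)
      fix y assume y: "y \<in> {-L<..<L}" "\<bar>y - x\<bar> < r/2"
      thus "\<bar>f y\<bar> \<le> C" using f[of y] C[of "y - x"] r by (auto simp: abs_if split: if_splits)
    qed
    thus ?thesis using r by (intro exI[of _ "r/2"]) auto
  qed
  then obtain r C where r: "\<And>x. x \<in> {-L..L} \<Longrightarrow> r x > 0"
    and C: "\<And>x y. x \<in> {-L..L} \<Longrightarrow> y \<in> {-L<..<L} \<Longrightarrow> \<bar>y - x\<bar> < r x \<Longrightarrow> \<bar>f y\<bar> \<le> C x"
    by metis
  obtain F where F: "F \<subseteq> {-L..L}" "finite F" "{-L..L} \<subseteq> (\<Union>x\<in>F. ball x (r x))"
    by (rule compactE_image[of "{-L..L}" "{-L..L}" "\<lambda>x. ball x (r x)"]) (use r in auto)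
  show ?thesis
  proof (rule that)
    fix t assume t: "t \<in> {-L<..<L}"
    hence "t \<in> {-L..L}" by simp
    from subsetD[OF F(3) this] obtain x where x: "x \<in> F" "\<bar>t - x\<bar> < r x"
      by (auto simp: dist_real_def abs_minus_commute)
    have "\<bar>f t\<bar> \<le> C x" using C[of x t] x t F(1) by auto
    also have "\<dots> \<le> (\<Sum>x\<in>F. \<bar>C x\<bar>)"
      using member_le_sum[of x F "\<lambda>x. \<bar>C x\<bar>"] x F(2) by fastforce
    finally show "\<bar>f t\<bar> \<le> (\<Sum>x\<in>F. \<bar>C x\<bar>)" .
  qed
qed

text \<open>Averaging the Taylor expansions at \<open>t\<close> and \<open>-t\<close> removes the odd terms.\<close>

lemma even_taylor:
  assumes "L > 0" "locally_power_series L f" "even_on {-L..L} f"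
  obtains a0 a2 C where "\<And>t. \<bar>t\<bar> < L \<Longrightarrow> \<bar>f t - a0 - a2 * t\<^sup>2\<bar> \<le> C * t ^ 4"
proof -
  define F where "F = (\<lambda>k. (deriv ^^ k) f)"
  have F: "locally_power_series L (F k)" for k
    by (induction k) (auto simp: F_def assms locally_power_series_deriv)
  have dF: "(F k has_real_derivative F (Suc k) t) (at t)" if "t \<in> {-L<..<L}" for k t
    using locally_power_series_deriv(1)[OF F that] by (simp add: F_def)
  obtain C where C: "\<And>t. t \<in> {-L<..<L} \<Longrightarrow> \<bar>F 4 t\<bar> \<le> C"
    using locally_power_series_bounded[OF F[of 4]] by blast
  have T: "\<exists>x. \<bar>x\<bar> \<le> C \<and> f t = F 0 0 + F 1 0 * t + F 2 0 / 2 * t\<^sup>2 + F 3 0 / 6 * t ^ 3 + x / 24 * t ^ 4"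
    if t: "\<bar>t\<bar> < L" for t
  proof -
    obtain u where "\<bar>u\<bar> \<le> \<bar>t\<bar>" "f t = (\<Sum>m<4. F m 0 / fact m * t ^ m) + F 4 u / fact 4 * t ^ 4"
    proof -
      have "F 0 = f" by (simp add: F_def)
      moreover have "\<forall>m u. m < 4 \<and> \<bar>u\<bar> \<le> \<bar>t\<bar> \<longrightarrow> (F m has_real_derivative F (Suc m) u) (at u)"
        using dF t by (smt (verit) greaterThanLessThan_iff)
      ultimately show ?thesis
        using Maclaurin_bi_le[of F f 4 t] that by blast
    qed
    moreover from this t have "\<bar>F 4 u\<bar> \<le> C" by (intro C) auto
    ultimately show ?thesis
      by (intro exI[of _ "F 4 u"] conjI) (simp_all add: eval_nat_numeral)
  qed
  show ?thesis
  proof (rule that)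
    fix t assume t: "\<bar>t\<bar> < L"
    obtain x where x: "\<bar>x\<bar> \<le> C" "f t = F 0 0 + F 1 0 * t + F 2 0 / 2 * t\<^sup>2 + F 3 0 / 6 * t ^ 3 + x / 24 * t ^ 4"
      using T[OF t] by blast
    obtain y where y: "\<bar>y\<bar> \<le> C" "f (- t) = F 0 0 + F 1 0 * (- t) + F 2 0 / 2 * (- t)\<^sup>2 + F 3 0 / 6 * (- t) ^ 3 + y / 24 * (- t) ^ 4"
      using T[of "- t"] t by auto
    have "f (- t) = f t" using assms(3) t unfolding even_on_def abs_less_iff by simp
    hence eq: "f t - F 0 0 - F 2 0 / 2 * t\<^sup>2 = (x + y) / 48 * t ^ 4"
      using x(2) y(2) by (simp add: algebra_simps)
    have "\<bar>(x + y) / 48\<bar> \<le> C" using x(1) y(1) by (auto simp: abs_le_iff)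
    thus "\<bar>f t - F 0 0 - F 2 0 / 2 * t\<^sup>2\<bar> \<le> C * t ^ 4"
      unfolding eq abs_mult by (intro mult_mono) auto
  qed
qed

section \<open>Consequences of condition A\<close>

lemma condition_AE:
  assumes "condition_A L c \<alpha> K"
  obtains A B D where "\<alpha> > 0" "\<forall>t\<in>{-L..L}. K t = A t + B t"
    "even_on {-L..L} A" "real_analytic_on {-L..L} A" "even_on {-L..L} B" "continuous_on {-L..L} B"
    "\<forall>t\<in>{0<..L}. D 0 t = B t"
    "\<forall>k. \<forall>t\<in>{0<..L}. (D k has_real_derivative D (Suc k) t) (at t within {0<..L})"
    "\<forall>k. (\<lambda>t. D k t - gamma_ratio \<alpha> k * c * t powr (\<alpha> - real k)) \<in> o[at_right 0](\<lambda>t. t powr (\<alpha> - real k))"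
  using assms unfolding condition_A_def by (elim conjE exE) (rule that; assumption)

text \<open>\<open>A\<close> supplies a0 + a2 t^2 up to O(t^4), and \<open>B\<close> supplies c
  |t|^\<alpha> up to a small relative error. C is chosen before \<epsilon>: the t^4 term is of
  smaller order when \<alpha> < 4 but dominates when \<alpha> > 4, so it must be kept apart.\<close>

lemma condition_A_expansion:
  assumes L: "L > 0" and K: "condition_A L c \<alpha> K"
  obtains a0 a2 C where "C \<ge> 0"
    and "\<forall>\<epsilon>>0. \<exists>\<delta>>0. \<forall>t. \<bar>t\<bar> \<le> \<delta> \<longrightarrow>
      \<bar>K t - (a0 + a2 * t\<^sup>2) - c * \<bar>t\<bar> powr \<alpha>\<bar> \<le> \<epsilon> * \<bar>t\<bar> powr \<alpha> + C * t ^ 4"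
proof -
  obtain A B D where \<alpha>: "\<alpha> > 0" and KAB: "\<forall>t\<in>{-L..L}. K t = A t + B t"
    and A: "even_on {-L..L} A" "real_analytic_on {-L..L} A"
    and B: "even_on {-L..L} B" "continuous_on {-L..L} B"
    and D0: "\<forall>t\<in>{0<..L}. D 0 t = B t"
    and Do: "\<forall>k. (\<lambda>t. D k t - gamma_ratio \<alpha> k * c * t powr (\<alpha> - real k)) \<in> o[at_right 0](\<lambda>t. t powr (\<alpha> - real k))"
    by (rule condition_AE[OF K]) (rule that; assumption)
  obtain a0 a2 C where A0: "\<And>t. \<bar>t\<bar> < L \<Longrightarrow> \<bar>A t - a0 - a2 * t\<^sup>2\<bar> \<le> C * t ^ 4"
    using even_taylor[OF L locally_power_series_if_real_analytic_on[OF L A(2)] A(1)] by blast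
  have "Gamma (\<alpha> + 1) > 0" by (rule Gamma_real_pos) (use \<alpha> in simp)
  hence "gamma_ratio \<alpha> 0 = 1" unfolding gamma_ratio_def by simp
  hence o0: "(\<lambda>t. D 0 t - c * t powr \<alpha>) \<in> o[at_right 0](\<lambda>t. t powr \<alpha>)"
    using Do[rule_format, of 0] by simp
  have Bpos: "\<exists>\<delta>>0. \<delta> < L \<and> (\<forall>t. 0 < t \<longrightarrow> t \<le> \<delta> \<longrightarrow> \<bar>B t - c * t powr \<alpha>\<bar> \<le> \<epsilon> * t powr \<alpha>)"
    if "\<epsilon> > 0" for \<epsilon>
  proof -
    from landau_o.smallD[OF o0 that]
    obtain b where b: "b > 0" "\<And>t. 0 < t \<Longrightarrow> t < b \<Longrightarrow> \<bar>D 0 t - c * t powr \<alpha>\<bar> \<le> \<epsilon> * t powr \<alpha>"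
      unfolding eventually_at_right_field by auto
    show ?thesis
    proof (intro exI[of _ "min b L / 2"] conjI allI impI)
      fix t assume t: "0 < t" "t \<le> min b L / 2"
      hence "t < b" "t \<in> {0<..L}" using b L by (auto simp: min_def split: if_splits)
      thus "\<bar>B t - c * t powr \<alpha>\<bar> \<le> \<epsilon> * t powr \<alpha>" using b(2)[of t] D0 t by simp
    qed (use b L in \<open>auto simp: min_def\<close>)
  qed
  \<comment> \<open>The asymptotics concern t > 0 only. The value at 0, which occurs whenever two
    nodes coincide, follows from continuity.\<close>
  have B0: "B 0 = 0"
  proof (rule tendsto_unique)
    show "(B \<longlongrightarrow> B 0) (at_right 0)"
      using continuous_on_Icc_at_rightD[of 0 L B] continuous_on_subset[OF B(2), of "{0..L}"] L by auto
    obtain \<delta> where \<delta>: "\<delta> > 0" "\<And>t. 0 < t \<Longrightarrow> t \<le> \<delta> \<Longrightarrow> \<bar>B t - c * t powr \<alpha>\<bar> \<le> 1 * t powr \<alpha>"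
      using Bpos[of 1] by auto
    show "(B \<longlongrightarrow> 0) (at_right 0)"
    proof (rule Lim_null_comparison)
      show "eventually (\<lambda>t. norm (B t) \<le> (\<bar>c\<bar> + 1) * t powr \<alpha>) (at_right 0)"
        unfolding eventually_at_right_field
      proof (intro exI[of _ \<delta>] conjI allI impI)
        fix t :: real assume "t > 0" "t < \<delta>"
        hence "\<bar>B t - c * t powr \<alpha>\<bar> \<le> t powr \<alpha>" using \<delta>(2)[of t] by simp
        moreover have "\<bar>c * t powr \<alpha>\<bar> = \<bar>c\<bar> * t powr \<alpha>" by (simp add: abs_mult)
        ultimately show "norm (B t) \<le> (\<bar>c\<bar> + 1) * t powr \<alpha>"
          unfolding real_norm_def distrib_right by linarith
      qed (use \<delta> in auto)
      have "((\<lambda>t::real. t powr \<alpha>) \<longlongrightarrow> 0 powr \<alpha>) (at_right 0)"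
        by (intro tendsto_powr' tendsto_intros) (use \<alpha> in \<open>auto simp: eventually_at_right_field intro: exI[of _ 1]\<close>)
      thus "((\<lambda>t. (\<bar>c\<bar> + 1) * t powr \<alpha>) \<longlongrightarrow> 0) (at_right 0)"
        by (intro tendsto_mult_right_zero) simp
    qed
  qed auto
  show ?thesis
  proof (rule that[of "max C 0" a0 a2], simp, intro allI impI)
    fix \<epsilon> :: real assume "\<epsilon> > 0"
    from Bpos[OF this] obtain \<delta> where \<delta>: "\<delta> > 0" "\<delta> < L"
      "\<And>t. 0 < t \<Longrightarrow> t \<le> \<delta> \<Longrightarrow> \<bar>B t - c * t powr \<alpha>\<bar> \<le> \<epsilon> * t powr \<alpha>" by auto
    have Bt: "\<bar>B t - c * \<bar>t\<bar> powr \<alpha>\<bar> \<le> \<epsilon> * \<bar>t\<bar> powr \<alpha>" if t: "\<bar>t\<bar> \<le> \<delta>" for t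
    proof (cases "t = 0")
      case False
      have "B \<bar>t\<bar> = B t"
        using B(1) t \<delta> unfolding even_on_def by (cases "t \<ge> 0") auto
      thus ?thesis using \<delta>(3)[of "\<bar>t\<bar>"] t False by simp
    qed (simp add: B0)
    have "\<bar>K t - (a0 + a2 * t\<^sup>2) - c * \<bar>t\<bar> powr \<alpha>\<bar> \<le> \<epsilon> * \<bar>t\<bar> powr \<alpha> + max C 0 * t ^ 4"
      if t: "\<bar>t\<bar> \<le> \<delta>" for t
    proof -
      have "t \<in> {-L..L}" using t \<delta> by auto
      hence "K t - (a0 + a2 * t\<^sup>2) - c * \<bar>t\<bar> powr \<alpha> = (A t - a0 - a2 * t\<^sup>2) + (B t - c * \<bar>t\<bar> powr \<alpha>)"
        using KAB by simp
      moreover have "\<bar>A t - a0 - a2 * t\<^sup>2\<bar> \<le> max C 0 * t ^ 4"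
        using A0[of t] t \<delta> mult_right_mono[of C "max C 0" "t ^ 4"] by simp
      ultimately show ?thesis using Bt[OF t] by linarith
    qed
    thus "\<exists>\<delta>>0. \<forall>t. \<bar>t\<bar> \<le> \<delta> \<longrightarrow>
      \<bar>K t - (a0 + a2 * t\<^sup>2) - c * \<bar>t\<bar> powr \<alpha>\<bar> \<le> \<epsilon> * \<bar>t\<bar> powr \<alpha> + max C 0 * t ^ 4"
      using \<delta>(1) by blast
  qed
qed

lemma condition_A_continuous:
  assumes "L > 0" "condition_A L c \<alpha> K"
  shows "continuous_on {-L..L} K"
proof -
  obtain A B where KAB: "\<forall>t\<in>{-L..L}. K t = A t + B t"
    and "real_analytic_on {-L..L} A" "continuous_on {-L..L} B"
    by (rule condition_AE[OF assms(2)]) (rule that; assumption)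
  hence "continuous_on {-L..L} (\<lambda>t. A t + B t)"
    using continuous_on_real_analytic_on[OF assms(1)] by (intro continuous_intros)
  thus ?thesis by (rule continuous_on_cong[THEN iffD1, rotated -1]) (use KAB in auto)
qed

lemma condition_A_even:
  assumes "condition_A L c \<alpha> K" "t \<in> {-L..L}"
  shows "K (- t) = K t"
proof -
  obtain A B where KAB: "\<forall>t\<in>{-L..L}. K t = A t + B t"
    and "even_on {-L..L} A" "even_on {-L..L} B"
    by (rule condition_AE[OF assms(1)]) (rule that; assumption)
  moreover have "- t \<in> {-L..L}" using assms(2) by auto
  ultimately show ?thesis using assms(2) unfolding even_on_def by metis
qed

text \<open>Near 0 the fourth derivative of \<open>B\<close> is of order t^(\<alpha>-4), elsewhere
  it is bounded. Truncating the exponent at 0 covers \<alpha> > 4, where the analytic part still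
  contributes a bounded term.\<close>

lemma condition_A_derivatives:
  assumes L: "L > 0" and K: "condition_A L c \<alpha> K"
  obtains F :: "nat \<Rightarrow> real \<Rightarrow> real" and C where "F 0 = K"
    and "\<And>k t. t \<in> {0<..<L} \<Longrightarrow> (F k has_real_derivative F (Suc k) t) (at t)"
    and "C \<ge> 0"
    and "\<And>t. t \<in> {0<..<L} \<Longrightarrow> \<bar>F 4 t\<bar> \<le> C * t powr - max (4 - \<alpha>) 0"
proof -
  obtain A B D where KAB: "\<forall>t\<in>{-L..L}. K t = A t + B t"
    and A: "real_analytic_on {-L..L} A"
    and D0: "\<forall>t\<in>{0<..L}. D 0 t = B t"
    and dD: "\<forall>k. \<forall>t\<in>{0<..L}. (D k has_real_derivative D (Suc k) t) (at t within {0<..L})"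
    and Do: "\<forall>k. (\<lambda>t. D k t - gamma_ratio \<alpha> k * c * t powr (\<alpha> - real k)) \<in> o[at_right 0](\<lambda>t. t powr (\<alpha> - real k))"
    by (rule condition_AE[OF K]) (rule that; assumption)
  define G where "G = (\<lambda>k. (deriv ^^ k) A)"
  have G: "locally_power_series L (G k)" for k
    by (induction k) (auto simp: G_def L A locally_power_series_if_real_analytic_on locally_power_series_deriv)
  have dG: "(G k has_real_derivative G (Suc k) t) (at t)" if "t \<in> {-L<..<L}" for k t
    using locally_power_series_deriv(1)[OF G that] by (simp add: G_def)
  obtain CA where CA: "\<And>t. t \<in> {-L<..<L} \<Longrightarrow> \<bar>G 4 t\<bar> \<le> CA"
    using locally_power_series_bounded[OF G[of 4]] by blast
  define p where "p = max (4 - \<alpha>) 0"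
  define g where "g = gamma_ratio \<alpha> 4 * c"
  have "(\<lambda>t. D 4 t - g * t powr (\<alpha> - 4)) \<in> o[at_right 0](\<lambda>t. t powr (\<alpha> - 4))"
    using Do[rule_format, of 4] by (simp add: g_def)
  from landau_o.smallD[OF this, of 1]
  obtain b where b: "b > 0" "\<And>t. 0 < t \<Longrightarrow> t < b \<Longrightarrow> \<bar>D 4 t - g * t powr (\<alpha> - 4)\<bar> \<le> t powr (\<alpha> - 4)"
    unfolding eventually_at_right_field by auto
  \<comment> \<open>b' < 1 makes t^(\<alpha>-4) \<le> t^(-p) a matter of comparing exponents, and b'
    < L leaves the compact interval [b', L] for the rest.\<close>
  define b' where "b' = min (min b L) 1 / 2"
  have b': "b' > 0" "b' < b" "b' < L" "b' < 1" using b L unfolding b'_def by (auto simp: min_def)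
  have near: "\<bar>D 4 t\<bar> \<le> (\<bar>g\<bar> + 1) * t powr - p" if t: "0 < t" "t \<le> b'" for t
  proof -
    have "\<bar>D 4 t - g * t powr (\<alpha> - 4)\<bar> \<le> t powr (\<alpha> - 4)" using b(2)[of t] t b' by simp
    moreover have "\<bar>g * t powr (\<alpha> - 4)\<bar> = \<bar>g\<bar> * t powr (\<alpha> - 4)" by (simp add: abs_mult)
    ultimately have "\<bar>D 4 t\<bar> \<le> (\<bar>g\<bar> + 1) * t powr (\<alpha> - 4)"
      unfolding distrib_right by linarith
    also have "t powr (\<alpha> - 4) \<le> t powr - p"
      by (rule powr_mono') (use t b' in \<open>auto simp: p_def\<close>)
    finally show ?thesis by (simp add: mult_left_mono)
  qed
  have "continuous_on {0<..L} (D 4)"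
    unfolding continuous_on_eq_continuous_within using dD by (blast intro: DERIV_continuous)
  hence "continuous_on {b'..L} (D 4)"
    by (rule continuous_on_subset) (use b' in auto)
  hence "bounded (D 4 ` {b'..L})" by (intro compact_imp_bounded compact_continuous_image) auto
  then obtain CD where CD: "\<And>t. t \<in> {b'..L} \<Longrightarrow> \<bar>D 4 t\<bar> \<le> CD"
    unfolding bounded_iff real_norm_def by blast
  \<comment> \<open>On (0, L] the power t^(-p) is at least L^(-p), so any constant can be absorbed
    into a multiple of it.\<close>
  have bnd: "c' \<le> \<bar>c'\<bar> * L powr p * t powr - p" if t: "0 < t" "t \<le> L" for t c' :: real
  proof -
    have "t powr p \<le> L powr p" by (rule powr_mono2) (use t in \<open>auto simp: p_def\<close>)
    hence "1 \<le> L powr p * t powr - p" using t by (simp add: powr_minus field_simps)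
    hence "\<bar>c'\<bar> * 1 \<le> \<bar>c'\<bar> * (L powr p * t powr - p)" by (rule mult_left_mono) simp
    thus ?thesis by (simp add: mult.assoc)
  qed
  \<comment> \<open>Order 0 is \<open>K\<close> itself because continuity on all of [-L, L] will be
    used for \<open>F 0\<close>, whereas \<open>D 0\<close> is tied to \<open>B\<close> only on (0,
    L].\<close>
  define F where "F = (\<lambda>k. if k = 0 then K else (\<lambda>t. G k t + D k t))"
  define C where "C = \<bar>CA\<bar> * L powr p + (\<bar>g\<bar> + 1) + \<bar>CD\<bar> * L powr p"
  show ?thesis
  proof (rule that[of F C])
    show "F 0 = K" by (simp add: F_def)
    show "C \<ge> 0" by (simp add: C_def)
    fix t assume t: "t \<in> {0<..<L}"
    have dGD: "((\<lambda>t. G k t + D k t) has_real_derivative G (Suc k) t + D (Suc k) t) (at t)" for k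
    proof -
      have "(D k has_real_derivative D (Suc k) t) (at t within {0<..<L})"
        by (rule DERIV_subset[OF dD[rule_format]]) (use t in auto)
      hence "(D k has_real_derivative D (Suc k) t) (at t)"
        using at_within_open[OF t] by simp
      thus ?thesis using dG[of t k] t L by (intro DERIV_add) auto
    qed
    show "(F k has_real_derivative F (Suc k) t) (at t)" for k
    proof (cases "k = 0")
      case True
      have "(K has_real_derivative G (Suc 0) t + D (Suc 0) t) (at t)"
        by (rule has_field_derivative_transform_within_open[OF dGD[of 0] _ t])
          (auto simp: G_def D0 KAB)
      thus ?thesis using True by (simp add: F_def)
    qed (use dGD[of k] in \<open>simp add: F_def\<close>)
    have nn: "0 \<le> t powr - p" "0 \<le> L powr p" by simp_all
    have "\<bar>G 4 t\<bar> \<le> \<bar>CA\<bar> * L powr p * t powr - p"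
      using CA[of t] bnd[of t CA] t L by force
    moreover have "\<bar>D 4 t\<bar> \<le> ((\<bar>g\<bar> + 1) + \<bar>CD\<bar> * L powr p) * t powr - p"
    proof (cases "t \<le> b'")
      case True
      thus ?thesis using near[of t] t nn by (simp add: distrib_right add_increasing2)
    next
      case False
      have "\<bar>D 4 t\<bar> \<le> \<bar>CD\<bar> * L powr p * t powr - p"
        using CD[of t] bnd[of t CD] t L False by force
      moreover have "0 \<le> (\<bar>g\<bar> + 1) * t powr - p" by simp
      ultimately show ?thesis unfolding distrib_right[of "\<bar>g\<bar> + 1"] by linarith
    qed
    ultimately have "\<bar>G 4 t + D 4 t\<bar> \<le> C * t powr - p"
      unfolding C_def distrib_right by linarith
    thus "\<bar>F 4 t\<bar> \<le> C * t powr - max (4 - \<alpha>) 0" by (simp add: F_def p_def)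
  qed
qed

section \<open>Second differences on a grid\<close>

text \<open>The mean spacing is half the distance of the outer nodes, so the weighted second
  difference is twice the second divided difference of f at the three nodes. The mean value theorem
  for divided differences makes it exact on irregular grids, which is the purpose of this
  weighting.\<close>

lemma second_difference_eq_deriv2:
  fixes f f1 f2 :: "real \<Rightarrow> real"
  assumes i: "i \<ge> 1" and ab: "s (i - 1) < s i" and bd: "s i < s (i + 1)"
    and cont: "continuous_on {s (i - 1)..s (i + 1)} f"
    and f1: "\<And>x. x \<in> {s (i - 1)<..<s (i + 1)} \<Longrightarrow> (f has_real_derivative f1 x) (at x)"
    and f2: "\<And>x. x \<in> {s (i - 1)<..<s (i + 1)} \<Longrightarrow> (f1 has_real_derivative f2 x) (at x)"
  obtains x where "x \<in> {s (i - 1)<..<s (i + 1)}" "second_difference s f i = f2 x"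
proof -
  define a b d where "a = s (i - 1)" and "b = s i" and "d = s (i + 1)"
  note abd = a_def[symmetric] b_def[symmetric] d_def[symmetric]
  have i1: "i - 1 + 1 = i" using i by simp
  have lt: "a < b" "b < d" using ab bd unfolding abd .
  define r where "r = (f b - f a) / (b - a)"
  define \<kappa> where "\<kappa> = second_difference s f i"
  have "\<kappa> = 2 / (d - a) * ((f d - f b) / (d - b) - r)"
    unfolding \<kappa>_def r_def second_difference_def mean_spacing_def spacing_def i1 abd
    by (simp add: inverse_eq_divide)
  moreover have "2 / e * v / 2 * e = v" if "e \<noteq> 0" for e v :: real using that by simp
  moreover have "d - a \<noteq> 0" using lt by simp
  ultimately have \<kappa>: "\<kappa> / 2 * (d - a) = (f d - f b) / (d - b) - r" by metis
  \<comment> \<open>The remainder of quadratic interpolation vanishes at all three nodes.\<close>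
  define q where "q = (\<lambda>x. f x - f a - r * (x - a) - \<kappa> / 2 * (x - a) * (x - b))"
  define q1 where "q1 = (\<lambda>x. f1 x - r - \<kappa> / 2 * (2 * x - a - b))"
  have qa: "q a = 0" by (simp add: q_def)
  have qb: "q b = 0" using lt by (simp add: q_def r_def)
  have "\<kappa> / 2 * (d - a) * (d - b) = f d - f b - r * (d - b)"
    using lt unfolding \<kappa> by (simp add: field_simps)
  moreover have "r * (b - a) = f b - f a" using lt by (simp add: r_def)
  ultimately have qd: "q d = 0" by (simp add: q_def algebra_simps)
  have q1: "(q has_real_derivative q1 x) (at x)" if "a < x" "x < d" for x
    using f1[of x] that unfolding q_def q1_def abd
    by (auto intro!: derivative_eq_intros simp: field_simps)
  have dq: "q differentiable (at x)" if "a < x" "x < d" for x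
    using q1[OF that] unfolding real_differentiable_def by blast
  have q2: "(q1 has_real_derivative f2 x - \<kappa>) (at x)" if "a < x" "x < d" for x
    using f2[of x] that unfolding q1_def abd
    by (auto intro!: derivative_eq_intros)
  have contq: "continuous_on {a..d} q"
    using cont unfolding q_def abd by (auto intro!: continuous_intros)
  have "\<exists>z>a. z < b \<and> (q has_real_derivative 0) (at z)"
    by (rule Rolle[OF lt(1)])
      (use qa qb dq lt in \<open>auto intro: continuous_on_subset[OF contq]\<close>)
  then obtain x1 where x1: "a < x1" "x1 < b" "(q has_real_derivative 0) (at x1)" by blast
  have "\<exists>z>b. z < d \<and> (q has_real_derivative 0) (at z)"
    by (rule Rolle[OF lt(2)])
      (use qb qd dq lt in \<open>auto intro: continuous_on_subset[OF contq]\<close>)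
  then obtain x2 where x2: "b < x2" "x2 < d" "(q has_real_derivative 0) (at x2)" by blast
  have z1: "q1 x1 = 0" using DERIV_unique[OF q1 x1(3)] x1 lt by simp
  have z2: "q1 x2 = 0" using DERIV_unique[OF q1 x2(3)] x2 lt by simp
  have dq1: "q1 differentiable (at x)" if "a < x" "x < d" for x
    using q2[OF that] unfolding real_differentiable_def by blast
  have "continuous_on {x1..x2} q1"
    by (rule continuous_at_imp_continuous_on) (use DERIV_isCont[OF q2] x1 x2 in auto)
  hence "\<exists>z>x1. z < x2 \<and> (q1 has_real_derivative 0) (at z)"
    by (intro Rolle) (use z1 z2 dq1 x1 x2 lt in auto)
  then obtain z where z: "x1 < z" "z < x2" "(q1 has_real_derivative 0) (at z)" by blast
  have "f2 z - \<kappa> = 0" using DERIV_unique[OF q2 z(3)] z x1 x2 by simp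
  moreover have "z \<in> {s (i - 1)<..<s (i + 1)}" unfolding abd using z x1 x2 by auto
  ultimately show ?thesis using that[of z] by (simp add: \<kappa>_def)
qed

section \<open>Second differences as weighted sums over three nodes\<close>

definition stencil :: "nat \<Rightarrow> nat set" where
  "stencil i = {i - 1..i + 1}"

lemma finite_stencil [simp]: "finite (stencil i)"
  by (simp add: stencil_def)

lemma card_stencil: "i \<ge> 1 \<Longrightarrow> card (stencil i) = 3"
  by (simp add: stencil_def)

lemma stencil_eq: "i \<ge> 1 \<Longrightarrow> stencil i = {i - 1, i, i + 1}"
  by (auto simp: stencil_def)

definition sd_weight :: "(nat \<Rightarrow> real) \<Rightarrow> nat \<Rightarrow> nat \<Rightarrow> real" where
  "sd_weight s i k = inverse (mean_spacing s i) *
     (if k = i + 1 then 1 / spacing s i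
      else if k = i then - (1 / spacing s i + 1 / spacing s (i - 1))
      else 1 / spacing s (i - 1))"

lemma second_difference_eq_sum:
  assumes "i \<ge> 1"
  shows "second_difference s f i = (\<Sum>k\<in>stencil i. sd_weight s i k * f (s k))"
proof -
  have "i - 1 \<noteq> i" "i - 1 \<noteq> i + 1" using assms by auto
  thus ?thesis unfolding second_difference_def sd_weight_def stencil_eq[OF assms]
    by (simp add: algebra_simps diff_divide_distrib)
qed

text \<open>For a stationary field with covariance function \<open>K\<close> this is the covariance
  of the second differences at i and j. The nested form lets the mean value argument run in one
  variable at a time.\<close>

definition cross_difference :: "(nat \<Rightarrow> real) \<Rightarrow> (real \<Rightarrow> real) \<Rightarrow> nat \<Rightarrow> nat \<Rightarrow> real" where
  "cross_difference s K i j = second_difference s (\<lambda>x. second_difference s (\<lambda>y. K (x - y)) j) i"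

lemma cross_difference_eq_sum:
  assumes "i \<ge> 1" "j \<ge> 1"
  shows "cross_difference s K i j =
    (\<Sum>k\<in>stencil i. \<Sum>l\<in>stencil j. sd_weight s i k * sd_weight s j l * K (s k - s l))"
  unfolding cross_difference_def using assms
  by (simp add: second_difference_eq_sum sum_distrib_left mult.assoc)

lemma cross_difference_diff:
  assumes "i \<ge> 1" "j \<ge> 1"
  shows "cross_difference s (\<lambda>t. f t - g t) i j = cross_difference s f i j - cross_difference s g i j"
  using assms by (simp add: cross_difference_eq_sum sum_subtractf right_diff_distrib)

lemma cross_difference_scale:
  assumes "i \<ge> 1" "j \<ge> 1"
  shows "cross_difference s (\<lambda>t. a * f t) i j = a * cross_difference s f i j"
  using assms by (simp add: cross_difference_eq_sum sum_distrib_left mult_ac)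

lemma cross_difference_swap:
  assumes "i \<ge> 1" "j \<ge> 1"
    and "\<And>k l. k \<in> stencil i \<Longrightarrow> l \<in> stencil j \<Longrightarrow> K (s k - s l) = K (s l - s k)"
  shows "cross_difference s K i j = cross_difference s K j i"
proof -
  have "cross_difference s K i j =
    (\<Sum>k\<in>stencil i. \<Sum>l\<in>stencil j. sd_weight s j l * sd_weight s i k * K (s l - s k))"
    unfolding cross_difference_eq_sum[OF assms(1,2)]
  proof (intro sum.cong refl)
    fix k l assume "k \<in> stencil i" "l \<in> stencil j"
    thus "sd_weight s i k * sd_weight s j l * K (s k - s l) =
        sd_weight s j l * sd_weight s i k * K (s l - s k)" using assms(3)[of k l] by simp
  qed
  also have "\<dots> = cross_difference s K j i"
    unfolding cross_difference_eq_sum[OF assms(2,1)] by (rule sum.swap)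
  finally show ?thesis .
qed

text \<open>One row of the array of grids. Since constants may not depend on the row, asymptotic
  bounds are stated outside the locale and quantified over its instances.\<close>

locale quasi_uniform_grid =
  fixes n :: nat and L m M :: real and s :: "nat \<Rightarrow> real"
  assumes L_pos: "L > 0" and m_pos: "m > 0"
    and first: "s 0 = 0" and last: "s n = L"
    and spacing_ge: "\<And>i. i < n \<Longrightarrow> m / real n \<le> spacing s i"
    and spacing_le: "\<And>i. i < n \<Longrightarrow> spacing s i \<le> M / real n"
begin

lemma n_pos: "n > 0"
  using first last L_pos by (cases n) auto

lemma spacing_pos: "i < n \<Longrightarrow> spacing s i > 0"
  using spacing_ge[of i] m_pos n_pos by (smt (verit) divide_pos_pos of_nat_0_less_iff)

lemma M_pos: "M > 0"
  using spacing_pos[of 0] spacing_le[of 0] n_pos by (smt (verit) divide_nonpos_pos of_nat_0_less_iff)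

lemma dist_ge: "i \<le> j \<Longrightarrow> j \<le> n \<Longrightarrow> real (j - i) * (m / real n) \<le> s j - s i"
proof (induction j rule: dec_induct)
  case (step k)
  thus ?case using spacing_ge[of k]
    by (simp add: spacing_def Suc_diff_le distrib_right add_divide_distrib)
qed simp

lemma dist_le: "i \<le> j \<Longrightarrow> j \<le> n \<Longrightarrow> s j - s i \<le> real (j - i) * (M / real n)"
proof (induction j rule: dec_induct)
  case (step k)
  thus ?case using spacing_le[of k]
    by (simp add: spacing_def Suc_diff_le distrib_right add_divide_distrib)
qed simp

lemma mono: "i \<le> j \<Longrightarrow> j \<le> n \<Longrightarrow> s i \<le> s j"
  using dist_ge[of i j] m_pos by (smt (verit) divide_nonneg_nonneg mult_nonneg_nonneg of_nat_0_le_iff)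

lemma less_Suc: "i < n \<Longrightarrow> s i < s (i + 1)"
  using spacing_pos[of i] by (simp add: spacing_def)

lemma bounds: "i \<le> n \<Longrightarrow> 0 \<le> s i" "i \<le> n \<Longrightarrow> s i \<le> L"
  using mono[of 0 i] mono[of i n] first last by auto

lemma mean_spacing_ge:
  assumes "i \<in> {1..<n}"
  shows "m / real n \<le> mean_spacing s i"
proof -
  have "i < n" "i - 1 < n" using assms by auto
  moreover have "x \<le> a \<Longrightarrow> x \<le> b \<Longrightarrow> x \<le> (a + b) / 2" for x a b :: real by simp
  ultimately show ?thesis unfolding mean_spacing_def by (metis spacing_ge)
qed

text \<open>All spacings and their means are at least m / n; the factor 2 is due to the central
  node, whose weight adds two reciprocal spacings.\<close>

lemma abs_sd_weight_le:
  assumes "i \<in> {1..<n}"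
  shows "\<bar>sd_weight s i k\<bar> \<le> 2 * (real n / m)\<^sup>2"
proof -
  have mn: "m / real n > 0" using m_pos n_pos by simp
  have inv: "1 / x \<le> real n / m" if "m / real n \<le> x" for x
    using le_imp_inverse_le[OF that mn] by (simp add: field_simps)
  have 1: "\<bar>inverse (mean_spacing s i)\<bar> \<le> real n / m"
    using inv[OF mean_spacing_ge[OF assms]] mean_spacing_ge[OF assms] mn
    by (simp add: inverse_eq_divide abs_of_pos)
  have p: "spacing s i > 0" "spacing s (i - 1) > 0" using spacing_pos[of i] spacing_pos[of "i - 1"] assms by auto
  have "1 / spacing s i \<le> real n / m" "1 / spacing s (i - 1) \<le> real n / m"
    using inv spacing_ge[of i] spacing_ge[of "i - 1"] assms by auto
  moreover have "1 / spacing s i > 0" "1 / spacing s (i - 1) > 0" using p by auto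
  ultimately have 2: "\<bar>if k = i + 1 then 1 / spacing s i
      else if k = i then - (1 / spacing s i + 1 / spacing s (i - 1))
      else 1 / spacing s (i - 1)\<bar> \<le> 2 * (real n / m)"
    by (smt (verit))
  have "\<bar>sd_weight s i k\<bar> \<le> (real n / m) * (2 * (real n / m))"
    unfolding sd_weight_def abs_mult by (rule mult_mono) (use 1 2 m_pos in auto)
  thus ?thesis by (simp add: power2_eq_square mult_ac)
qed

lemma abs_cross_difference_le:
  assumes "i \<in> {1..<n}" "j \<in> {1..<n}"
    and "\<And>k l. k \<in> stencil i \<Longrightarrow> l \<in> stencil j \<Longrightarrow> \<bar>R (s k - s l)\<bar> \<le> b"
  shows "\<bar>cross_difference s R i j\<bar> \<le> 36 * (real n / m) ^ 4 * b"
proof -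
  let ?w = "2 * (real n / m)\<^sup>2"
  have "\<bar>cross_difference s R i j\<bar> \<le> (\<Sum>k\<in>stencil i. \<bar>\<Sum>l\<in>stencil j. sd_weight s i k * sd_weight s j l * R (s k - s l)\<bar>)"
    using assms by (subst cross_difference_eq_sum) auto
  also have "\<dots> \<le> (\<Sum>k\<in>stencil i. \<Sum>l\<in>stencil j. \<bar>sd_weight s i k * sd_weight s j l * R (s k - s l)\<bar>)"
    by (intro sum_mono sum_abs)
  also have "\<dots> \<le> (\<Sum>k\<in>stencil i. \<Sum>l\<in>stencil j. ?w * ?w * b)"
    unfolding abs_mult using assms by (intro sum_mono mult_mono abs_sd_weight_le) auto
  \<comment> \<open>There are nine pairs of nodes, and two weights multiply to at most 4 (n / m)^4,
    whence 36.\<close>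
  also have "\<dots> = real (card (stencil i) * card (stencil j)) * (?w * ?w * b)"
    by simp
  also have "card (stencil i) = 3" by (rule card_stencil) (use assms in simp)
  also have "card (stencil j) = 3" by (rule card_stencil) (use assms in simp)
  finally show ?thesis by (simp add: power2_eq_square power4_eq_xxxx)
qed

lemma cross_difference_quadratic:
  assumes "i \<in> {1..<n}" "j \<in> {1..<n}"
  shows "cross_difference s (\<lambda>t. a0 + a2 * t\<^sup>2) i j = 0"
proof -
  have "second_difference s (\<lambda>y. a0 + a2 * (x - y)\<^sup>2) j = 2 * a2" for x
  proof -
    \<comment> \<open>The second derivative is constant, so the mean value form gives the exact
      value wherever the intermediate point lies. The outer difference then annihilates this
      constant.\<close>
    have "\<exists>y. second_difference s (\<lambda>y. a0 + a2 * (x - y)\<^sup>2) j = (\<lambda>y. 2 * a2) y"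
      by (rule second_difference_eq_deriv2[of j s "\<lambda>y. a0 + a2 * (x - y)\<^sup>2"
            "\<lambda>y. - 2 * a2 * (x - y)" "\<lambda>y. 2 * a2"])
        (use assms less_Suc[of "j - 1"] less_Suc[of j] in
          \<open>auto intro!: continuous_intros derivative_eq_intros simp: algebra_simps\<close>)
    thus ?thesis by simp
  qed
  thus ?thesis unfolding cross_difference_def by (simp add: second_difference_def)
qed

text \<open>For j + 3 \<le> i the stencils are disjoint, their closest nodes i - 1 and j + 1 being i
  - j - 2 spacings apart. All arguments x - y are then positive and avoid the singularity at
  0.\<close>

lemma cross_difference_eq_deriv4:
  fixes F :: "nat \<Rightarrow> real \<Rightarrow> real"
  assumes ij: "i \<in> {1..<n}" "j \<in> {1..<n}" "j + 3 \<le> i"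
    and cont: "continuous_on {-L..L} (F 0)"
    and F: "\<And>k t. t \<in> {0<..<L} \<Longrightarrow> (F k has_real_derivative F (Suc k) t) (at t)"
  obtains t where "t \<in> {0<..<L}" "real (i - j - 2) * (m / real n) \<le> t"
    "cross_difference s (F 0) i j = F 4 t"
proof -
  have i1: "i - 1 + 1 = i" "j - 1 + 1 = j" using ij by auto
  have i2: "j + 1 + 1 \<le> i - 1" "i - 1 < n" using ij by auto
  have "s (j + 1) < s (j + 1 + 1)" by (rule less_Suc) (use ij in auto)
  also have "\<dots> \<le> s (i - 1)" by (rule mono) (use i2 in auto)
  finally have b4: "s (j + 1) < s (i - 1)" .
  have b1: "0 \<le> s (j - 1)" by (rule bounds) (use ij in auto)
  have b7: "s (i + 1) \<le> L" by (rule bounds) (use ij in auto)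
  have b3: "s j < s (j + 1)" "s i < s (i + 1)" by (rule less_Suc; use ij in auto)+
  have "s (j - 1) < s (j - 1 + 1)" "s (i - 1) < s (i - 1 + 1)" by (rule less_Suc; use ij in auto)+
  hence b2: "s (j - 1) < s j" "s (i - 1) < s i" unfolding i1 .
  note b = b1 b2(1) b3(1) b4 b2(2) b3(2) b7
  have dist: "real (i - j - 2) * (m / real n) \<le> s (i - 1) - s (j + 1)"
    using dist_ge[of "j + 1" "i - 1"] ij by (simp add: diff_diff_eq)
  \<comment> \<open>The inner difference is a finite combination of shifts, hence differentiable in
    x. The point x is fixed before the mean value form is applied in y, so no dependence of y on x
    has to be differentiated.\<close>
  define g where "g = (\<lambda>k x. second_difference s (\<lambda>y. F k (x - y)) j)"
  have g_sum: "g k = (\<lambda>x. \<Sum>l\<in>stencil j. sd_weight s j l * F k (x - s l))" for k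
    using ij by (auto simp: g_def second_difference_eq_sum)
  have sl: "s (j - 1) \<le> s l" "s l \<le> s (j + 1)" if "l \<in> stencil j" for l
    using mono[of "j - 1" l] mono[of l "j + 1"] that ij by (auto simp: stencil_def)
  have "continuous_on {s (i - 1)..s (i + 1)} (\<lambda>x. F 0 (x - s l))" if "l \<in> stencil j" for l
    by (rule continuous_on_compose2[OF cont]) (use sl[OF that] b in \<open>auto intro!: continuous_intros\<close>)
  hence cont_g: "continuous_on {s (i - 1)..s (i + 1)} (g 0)"
    unfolding g_sum by (intro continuous_intros) auto
  have dg: "(g k has_real_derivative g (Suc k) x) (at x)" if x: "x \<in> {s (i - 1)<..<s (i + 1)}" for k x
  proof -
    have "((\<lambda>x. F k (x - s l)) has_real_derivative F (Suc k) (x - s l)) (at x)" if "l \<in> stencil j" for l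
      using DERIV_shift[THEN iffD1, of "F k" _ x "- s l"] F[of "x - s l"] sl[OF that] x b by simp
    thus ?thesis unfolding g_sum by (intro DERIV_sum DERIV_cmult) auto
  qed
  obtain x where x: "x \<in> {s (i - 1)<..<s (i + 1)}" "second_difference s (g 0) i = g 2 x"
    by (rule second_difference_eq_deriv2[of i s "g 0" "g 1" "g 2"])
      (use ij b cont_g dg[of _ 0] dg[of _ 1] in \<open>auto simp: numeral_2_eq_2\<close>)
  have dF: "((\<lambda>y. F k (x - y)) has_real_derivative - F (Suc k) (x - y)) (at y)"
    if y: "y \<in> {s (j - 1)..s (j + 1)}" for k y
  proof -
    have "(F k has_real_derivative F (Suc k) (x - y)) (at (x - y))"
      by (rule F) (use x y b in auto)
    moreover have "((\<lambda>y. x - y) has_real_derivative - 1) (at y)"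
      by (auto intro!: derivative_eq_intros)
    ultimately show ?thesis
      using DERIV_chain'[of "\<lambda>y. x - y" "- 1" y UNIV "F k" "F (Suc k) (x - y)"] by simp
  qed
  obtain y where y: "y \<in> {s (j - 1)<..<s (j + 1)}" "second_difference s (\<lambda>y. F 2 (x - y)) j = F 4 (x - y)"
  \<comment> \<open>Each derivative in y brings a minus sign, and the two cancel.\<close>
  proof (rule second_difference_eq_deriv2[of j s "\<lambda>y. F 2 (x - y)" "\<lambda>y. - F 3 (x - y)" "\<lambda>y. F 4 (x - y)"])
    show "continuous_on {s (j - 1)..s (j + 1)} (\<lambda>y. F 2 (x - y))"
      by (rule continuous_at_imp_continuous_on) (use dF in \<open>blast intro: DERIV_isCont\<close>)
    show "((\<lambda>y. F 2 (x - y)) has_real_derivative - F 3 (x - y)) (at y)"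
      if "y \<in> {s (j - 1)<..<s (j + 1)}" for y
      using dF[of y 2] that by (simp add: numeral_3_eq_3 numeral_2_eq_2)
    show "((\<lambda>y. - F 3 (x - y)) has_real_derivative F 4 (x - y)) (at y)"
      if "y \<in> {s (j - 1)<..<s (j + 1)}" for y
      using DERIV_minus[OF dF[of y 3]] that by (simp add: eval_nat_numeral)
  qed (use ij b in auto)
  show ?thesis
    by (rule that[of "x - y"]) (use x y b dist in \<open>auto simp: cross_difference_def g_def\<close>)
qed

end

section \<open>Covariances of second differences\<close>

context quasi_uniform_grid
begin

lemma node_diff_mem:
  assumes "i \<in> {1..<n}" "j \<in> {1..<n}" "k \<in> stencil i" "l \<in> stencil j"
  shows "s k - s l \<in> {-L..L}"
  using bounds[of k] bounds[of l] assms by (auto simp: stencil_def)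

text \<open>The constant 4 is 2 for |i - j| plus 1 for the reach of each stencil.\<close>

lemma abs_node_diff_le:
  assumes "i \<in> {1..<n}" "j \<in> {1..<n}" "k \<in> stencil i" "l \<in> stencil j" "i \<le> j + 2" "j \<le> i + 2"
  shows "\<bar>s k - s l\<bar> \<le> 4 * (M / real n)"
proof -
  have kl: "k \<le> n" "l \<le> n" "k - l \<le> 4" "l - k \<le> 4" using assms by (auto simp: stencil_def)
  have Mn: "M / real n \<ge> 0" using M_pos by simp
  have le: "real d * (M / real n) \<le> 4 * (M / real n)" if "d \<le> 4" for d
    by (rule mult_right_mono) (use that Mn in auto)
  show ?thesis
  proof (cases "k \<le> l")
    case True
    thus ?thesis using dist_le[of k l] le[of "l - k"] mono[of k l] kl by linarith
  next
    case False
    thus ?thesis using dist_le[of l k] le[of "k - l"] mono[of l k] kl by linarith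
  qed
qed

text \<open>Collecting the nine terms leaves each power divided by its own length, hence the
  exponent \<alpha> - 1. The bracket vanishes for \<alpha> = 2, as it must for a quadratic.\<close>

lemma cross_difference_powr:
  assumes i: "i \<in> {1..<n}" and \<alpha>: "\<alpha> > 0"
  defines "h \<equiv> spacing s (i - 1)" and "g \<equiv> spacing s i"
  shows "cross_difference s (\<lambda>t. \<bar>t\<bar> powr \<alpha>) i i =
    8 / ((h + g) * h * g) * ((h + g) powr (\<alpha> - 1) - h powr (\<alpha> - 1) - g powr (\<alpha> - 1))"
proof -
  have pos: "h > 0" "g > 0" using spacing_pos[of i] spacing_pos[of "i - 1"] i by (auto simp: h_def g_def)
  have i1: "i - 1 + 1 = i" using i by auto
  have d: "s (i + 1) - s i = g" "s i - s (i + 1) = - g" "s i - s (i - 1) = h" "s (i - 1) - s i = - h"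
    "s (i + 1) - s (i - 1) = h + g" "s (i - 1) - s (i + 1) = - (h + g)"
    using i1 by (simp_all add: h_def g_def spacing_def)
  have ms: "inverse (mean_spacing s i) = 2 / (h + g)"
    by (simp add: mean_spacing_def h_def g_def)
  note hg = h_def[symmetric] g_def[symmetric]
  define P where "P = h powr \<alpha>"
  define Q where "Q = g powr \<alpha>"
  define R where "R = (h + g) powr \<alpha>"
  have pw: "\<bar>g\<bar> powr \<alpha> = Q" "\<bar>- g\<bar> powr \<alpha> = Q" "\<bar>h\<bar> powr \<alpha> = P" "\<bar>- h\<bar> powr \<alpha> = P"
    "\<bar>h + g\<bar> powr \<alpha> = R" "\<bar>- (h + g)\<bar> powr \<alpha> = R" "\<bar>0 :: real\<bar> powr \<alpha> = 0"
    using pos unfolding P_def Q_def R_def by (simp_all add: abs_of_neg add.commute)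
  have "cross_difference s (\<lambda>t. \<bar>t\<bar> powr \<alpha>) i i =
     2 / (h + g) * ((2 / (h + g) * ((0 - Q) / g - (Q - R) / h) - 2 / (h + g) * ((Q - 0) / g - (0 - P) / h)) / g
       - (2 / (h + g) * ((Q - 0) / g - (0 - P) / h) - 2 / (h + g) * ((R - P) / g - (P - 0) / h)) / h)"
    unfolding cross_difference_def second_difference_def ms hg d pw diff_self by simp
  also have "\<dots> = 8 / ((h + g) * h * g) * (R / (h + g) - P / h - Q / g)"
  proof -
    have "h + g \<noteq> 0" "h \<noteq> 0" "g \<noteq> 0" using pos by auto
    thus ?thesis by (simp add: divide_simps) (simp add: algebra_simps)
  qed
  also have "R / (h + g) = (h + g) powr (\<alpha> - 1)" using pos by (simp add: R_def powr_diff)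
  also have "P / h = h powr (\<alpha> - 1)" using pos by (simp add: P_def powr_diff)
  also have "Q / g = g powr (\<alpha> - 1)" using pos by (simp add: Q_def powr_diff)
  finally show ?thesis .
qed

end

text \<open>After scaling, the summands are u and 1 - u in (0, 1). Both powers exceed their bases if
  p < 1, and both fall below them if p > 1. Negative p occurs later, for \<alpha> < 1.\<close>

lemma powr_add_neq:
  fixes x y p :: real
  assumes "x > 0" "y > 0" "p \<noteq> 1"
  shows "(x + y) powr p \<noteq> x powr p + y powr p"
proof -
  define u where "u = x / (x + y)"
  have u: "0 < u" "u < 1" "1 - u = y / (x + y)" using assms by (auto simp: u_def field_simps)
  have "u powr p + (1 - u) powr p \<noteq> 1"
  proof (cases "p < 1")
    case True
    hence "u < u powr p" "1 - u < (1 - u) powr p"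
      using powr_less_mono'[of u p 1] powr_less_mono'[of "1 - u" p 1] u(1,2) by simp_all
    thus ?thesis by linarith
  next
    case False
    hence "u powr p < u" "(1 - u) powr p < 1 - u"
      using powr_less_mono'[of u 1 p] powr_less_mono'[of "1 - u" 1 p] u(1,2) assms(3) by simp_all
    thus ?thesis by linarith
  qed
  moreover have "x powr p = (x + y) powr p * u powr p" "y powr p = (x + y) powr p * (1 - u) powr p"
    unfolding u(3) using assms by (simp_all add: u_def powr_divide)
  hence "x powr p + y powr p = (x + y) powr p * (u powr p + (1 - u) powr p)"
    by (simp only: distrib_left)
  moreover have "(x + y) powr p \<noteq> 0" using assms by simp
  ultimately show ?thesis by simp
qed

text \<open>The bracket is homogeneous in the spacings, and spacings multiplied by n lie in the
  compact square [m, M]^2. There its absolute value is continuous and never 0, so its minimum is a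
  positive constant valid for all grids.\<close>

lemma cross_difference_powr_lower:
  assumes "m > 0" "\<alpha> > 0" "\<alpha> \<noteq> 2"
  obtains \<kappa> where "\<kappa> > 0"
    "\<And>n L s i. quasi_uniform_grid n L m M s \<Longrightarrow> i \<in> {1..<n} \<Longrightarrow>
      \<kappa> * real n powr (4 - \<alpha>) \<le> \<bar>cross_difference s (\<lambda>t. \<bar>t\<bar> powr \<alpha>) i i\<bar>"
proof (cases "m \<le> M")
  case mM: True
  define \<phi> where "\<phi> = (\<lambda>(x::real, y). \<bar>(x + y) powr (\<alpha> - 1) - x powr (\<alpha> - 1) - y powr (\<alpha> - 1)\<bar>)"
  have cont: "continuous_on ({m..M} \<times> {m..M}) \<phi>"
    unfolding \<phi>_def case_prod_beta using assms by (intro continuous_intros) auto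
  have "\<exists>z\<in>{m..M} \<times> {m..M}. \<forall>w\<in>{m..M} \<times> {m..M}. \<phi> z \<le> \<phi> w"
    using mM by (intro continuous_attains_inf cont) (auto intro!: compact_Times)
  then obtain z where z: "z \<in> {m..M} \<times> {m..M}" "\<And>w. w \<in> {m..M} \<times> {m..M} \<Longrightarrow> \<phi> z \<le> \<phi> w"
    by blast
  have "\<phi> z > 0"
    using powr_add_neq[of "fst z" "snd z" "\<alpha> - 1"] z(1) assms by (auto simp: \<phi>_def)
  \<comment> \<open>Spacings are at most M / n, so the prefactor 8 / ((h + g) h g) is at least 8 n^3
    / (2 M^3).\<close>
  hence \<kappa>: "4 / M ^ 3 * \<phi> z > 0" using mM assms by simp
  show ?thesis
  proof (rule that[OF \<kappa>])
    fix n L s i assume "quasi_uniform_grid n L m M s" and i: "i \<in> {1..<n}"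
    then interpret quasi_uniform_grid n L m M s by simp
    define h where "h = spacing s (i - 1)"
    define g where "g = spacing s i"
    have n: "real n > 0" using n_pos by simp
    have b: "m / real n \<le> h" "h \<le> M / real n" "m / real n \<le> g" "g \<le> M / real n"
      using i spacing_ge[of i] spacing_le[of i] spacing_ge[of "i - 1"] spacing_le[of "i - 1"]
      by (auto simp: h_def g_def)
    have pos: "h > 0" "g > 0" using spacing_pos[of i] spacing_pos[of "i - 1"] i by (auto simp: h_def g_def)
    have "(real n * h, real n * g) \<in> {m..M} \<times> {m..M}"
      using b n by (auto simp: field_simps)
    hence "\<phi> z \<le> \<phi> (real n * h, real n * g)" by (rule z)
    also have "\<phi> (real n * h, real n * g) =
        real n powr (\<alpha> - 1) * \<bar>(h + g) powr (\<alpha> - 1) - h powr (\<alpha> - 1) - g powr (\<alpha> - 1)\<bar>"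
    proof -
      have "(real n * h + real n * g) powr (\<alpha> - 1) = real n powr (\<alpha> - 1) * (h + g) powr (\<alpha> - 1)"
        using n pos by (simp flip: distrib_left add: powr_mult)
      thus ?thesis using n pos
        by (simp add: \<phi>_def powr_mult flip: right_diff_distrib) (simp add: abs_mult)
    qed
    finally have 1: "\<phi> z * real n powr (1 - \<alpha>) \<le> \<bar>(h + g) powr (\<alpha> - 1) - h powr (\<alpha> - 1) - g powr (\<alpha> - 1)\<bar>"
      using n by (simp add: field_simps powr_diff)
    have "(h + g) * h * g \<le> (2 * (M / real n)) * (M / real n) * (M / real n)"
      using b pos M_pos n by (intro mult_mono) auto
    also have "\<dots> = 2 * M ^ 3 / real n ^ 3" by (simp add: power3_eq_cube)
    finally have "8 / (2 * M ^ 3 / real n ^ 3) \<le> 8 / ((h + g) * h * g)"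
      using pos by (intro divide_left_mono) (use M_pos n in auto)
    hence 2: "4 / M ^ 3 * real n ^ 3 \<le> 8 / ((h + g) * h * g)" by simp
    have "4 / M ^ 3 * \<phi> z * real n powr (4 - \<alpha>) = (4 / M ^ 3 * real n ^ 3) * (\<phi> z * real n powr (1 - \<alpha>))"
    proof -
      have "real n powr (4 - \<alpha>) = real n powr (3 + (1 - \<alpha>))" by simp
      also have "\<dots> = real n powr 3 * real n powr (1 - \<alpha>)" by (rule powr_add)
      also have "real n powr 3 = real n ^ 3" using n powr_realpow[of "real n" 3] by simp
      finally show ?thesis by simp
    qed
    also have "\<dots> \<le> 8 / ((h + g) * h * g) * \<bar>(h + g) powr (\<alpha> - 1) - h powr (\<alpha> - 1) - g powr (\<alpha> - 1)\<bar>"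
      by (rule mult_mono[OF 2 1]) (use pos \<open>\<phi> z > 0\<close> in auto)
    also have "\<dots> = \<bar>cross_difference s (\<lambda>t. \<bar>t\<bar> powr \<alpha>) i i\<bar>"
      unfolding cross_difference_powr[OF i \<open>\<alpha> > 0\<close>] abs_mult h_def[symmetric] g_def[symmetric]
      using pos by simp
    finally show "4 / M ^ 3 * \<phi> z * real n powr (4 - \<alpha>) \<le> \<bar>cross_difference s (\<lambda>t. \<bar>t\<bar> powr \<alpha>) i i\<bar>" .
  qed
next
  \<comment> \<open>For M < m there are no such grids and any constant serves.\<close>
  case False
  show ?thesis
  proof (rule that[of 1])
    fix n L s i assume "quasi_uniform_grid n L m M s"
    then interpret quasi_uniform_grid n L m M s by simp
    have "m / real n \<le> M / real n" using spacing_ge[of 0] spacing_le[of 0] n_pos by linarith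
    hence "m \<le> M" using n_pos by (simp add: divide_le_cancel)
    thus "1 * real n powr (4 - \<alpha>) \<le> \<bar>cross_difference s (\<lambda>t. \<bar>t\<bar> powr \<alpha>) i i\<bar>" using False by simp
  qed simp
qed

text \<open>Second differences in both arguments annihilate the terms \<open>a\<^sub>0 + a\<^sub>2 t\<^sup>2\<close> in the expansion of \<open>K\<close> at
  \<open>0\<close>, so that \<open>c |t|\<^sup>\<alpha>\<close> dominates near the diagonal.\<close>

lemma cross_difference_remainder:
  assumes "L > 0" "m > 0" "M > 0" "condition_A L c \<alpha> K"
  obtains C where "C \<ge> 0" "\<forall>\<epsilon>>0. \<exists>N. \<forall>n\<ge>N. \<forall>s. quasi_uniform_grid n L m M s \<longrightarrow>
     (\<forall>i\<in>{1..<n}. \<forall>j\<in>{1..<n}. i \<le> j + 2 \<longrightarrow> j \<le> i + 2 \<longrightarrow>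
       \<bar>cross_difference s K i j - c * cross_difference s (\<lambda>t. \<bar>t\<bar> powr \<alpha>) i j\<bar>
         \<le> C * (\<epsilon> * real n powr (4 - \<alpha>) + 1))"
proof -
  have \<alpha>: "\<alpha> > 0" using assms(4) unfolding condition_A_def by simp
  obtain a0 a2 C where C: "C \<ge> 0" and exp: "\<forall>\<epsilon>>0. \<exists>\<delta>>0. \<forall>t. \<bar>t\<bar> \<le> \<delta> \<longrightarrow>
      \<bar>K t - (a0 + a2 * t\<^sup>2) - c * \<bar>t\<bar> powr \<alpha>\<bar> \<le> \<epsilon> * \<bar>t\<bar> powr \<alpha> + C * t ^ 4"
    by (rule condition_A_expansion[OF assms(1,4)])
  \<comment> \<open>36 / m^4 stems from the weights, and 4 M / n bounds |t| for nearby stencils. The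
    factor n^4 of the weights turns t^4 into a constant and |t|^\<alpha> into
    n^(4-\<alpha>).\<close>
  define C' where "C' = 36 / m ^ 4 * ((4 * M) powr \<alpha> + C * (4 * M) ^ 4)"
  show ?thesis
  proof (rule that[of C'], goal_cases)
    case 1
    show ?case using C assms by (simp add: C'_def)
  next
    case 2
    show ?case
  proof (intro allI impI)
    fix \<epsilon> :: real assume \<epsilon>: "\<epsilon> > 0"
    from exp[rule_format, OF this] obtain \<delta> where \<delta>: "\<delta> > 0" "\<And>t. \<bar>t\<bar> \<le> \<delta> \<Longrightarrow>
      \<bar>K t - (a0 + a2 * t\<^sup>2) - c * \<bar>t\<bar> powr \<alpha>\<bar> \<le> \<epsilon> * \<bar>t\<bar> powr \<alpha> + C * t ^ 4" by blast
    define N where "N = nat \<lceil>4 * M / \<delta>\<rceil>"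
    have "\<bar>cross_difference s K i j - c * cross_difference s (\<lambda>t. \<bar>t\<bar> powr \<alpha>) i j\<bar>
         \<le> C' * (\<epsilon> * real n powr (4 - \<alpha>) + 1)"
      if "n \<ge> N" "quasi_uniform_grid n L m M s" and ij: "i \<in> {1..<n}" "j \<in> {1..<n}" "i \<le> j + 2" "j \<le> i + 2"
      for n s i j
    proof -
      interpret quasi_uniform_grid n L m M s by fact
      have n: "real n > 0" using n_pos by simp
      have "4 * M / \<delta> \<le> real n" using \<open>n \<ge> N\<close> unfolding N_def by linarith
      hence small: "4 * (M / real n) \<le> \<delta>" using n \<delta>(1) by (simp add: field_simps)
      define R where "R = (\<lambda>t. K t - (a0 + a2 * t\<^sup>2) - c * \<bar>t\<bar> powr \<alpha>)"
      define b where "b = \<epsilon> * (4 * (M / real n)) powr \<alpha> + C * (4 * (M / real n)) ^ 4"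
      have "\<bar>R (s k - s l)\<bar> \<le> b" if kl: "k \<in> stencil i" "l \<in> stencil j" for k l
      proof -
        have t: "\<bar>s k - s l\<bar> \<le> 4 * (M / real n)" by (rule abs_node_diff_le[OF ij(1,2) kl ij(3,4)])
        hence "\<bar>R (s k - s l)\<bar> \<le> \<epsilon> * \<bar>s k - s l\<bar> powr \<alpha> + C * \<bar>s k - s l\<bar> ^ 4"
          using \<delta>(2)[of "s k - s l"] small by (simp add: R_def)
        also have "\<dots> \<le> b" unfolding b_def
          using t \<epsilon> C \<alpha> by (intro add_mono mult_left_mono powr_mono2 power_mono) auto
        finally show ?thesis .
      qed
      hence "\<bar>cross_difference s R i j\<bar> \<le> 36 * (real n / m) ^ 4 * b"
        by (rule abs_cross_difference_le[OF ij(1,2)])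
      also have "cross_difference s R i j = cross_difference s K i j - c * cross_difference s (\<lambda>t. \<bar>t\<bar> powr \<alpha>) i j"
        using ij by (simp add: R_def cross_difference_diff cross_difference_scale cross_difference_quadratic)
      also have "36 * (real n / m) ^ 4 * b =
          36 / m ^ 4 * ((4 * M) powr \<alpha> * (\<epsilon> * real n powr (4 - \<alpha>)) + C * (4 * M) ^ 4)"
      proof -
        have 1: "(4 * (M / real n)) powr \<alpha> = (4 * M) powr \<alpha> / real n powr \<alpha>"
          using n M_pos powr_divide[of "4 * M" "real n" \<alpha>] by simp
        have 2: "real n powr (4 - \<alpha>) = real n ^ 4 / real n powr \<alpha>"
          using n powr_realpow[of "real n" 4] by (simp add: powr_diff)
        show ?thesis unfolding b_def 1 2 using n m_pos
          by (simp add: field_simps power_divide power_mult_distrib)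
      qed
      also have "\<dots> \<le> C' * (\<epsilon> * real n powr (4 - \<alpha>) + 1)"
      proof -
        have "0 \<le> (4 * M) powr \<alpha>" "0 \<le> C * (4 * M) ^ 4" "0 \<le> \<epsilon> * real n powr (4 - \<alpha>)" using C M_pos \<epsilon> by auto
        moreover have "x * z + y \<le> (x + y) * (z + 1)" if "0 \<le> x" "0 \<le> y" "0 \<le> z" for x y z :: real
          using that by (simp add: algebra_simps)
        ultimately have "(4 * M) powr \<alpha> * (\<epsilon> * real n powr (4 - \<alpha>)) + C * (4 * M) ^ 4 \<le>
          ((4 * M) powr \<alpha> + C * (4 * M) ^ 4) * (\<epsilon> * real n powr (4 - \<alpha>) + 1)"
          by blast
        thus ?thesis unfolding C'_def mult.assoc using m_pos by (intro mult_left_mono) auto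
      qed
      finally show ?thesis .
    qed
    thus "\<exists>N. \<forall>n\<ge>N. \<forall>s. quasi_uniform_grid n L m M s \<longrightarrow>
     (\<forall>i\<in>{1..<n}. \<forall>j\<in>{1..<n}. i \<le> j + 2 \<longrightarrow> j \<le> i + 2 \<longrightarrow>
       \<bar>cross_difference s K i j - c * cross_difference s (\<lambda>t. \<bar>t\<bar> powr \<alpha>) i j\<bar>
         \<le> C' * (\<epsilon> * real n powr (4 - \<alpha>) + 1))" by blast
  qed
  qed
qed

text \<open>This is 1 + |i - j| through truncated subtraction; the 1 keeps quotients by it
  meaningful on the diagonal.\<close>

definition gap :: "nat \<Rightarrow> nat \<Rightarrow> nat" where
  "gap i j = 1 + (i - j) + (j - i)"

lemma gap_commute: "gap i j = gap j i"
  by (simp add: gap_def)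

text \<open>Only lower bounds on distances enter, as t^(-p) does not increase with t. Hence the
  constant is independent of M and no threshold for n appears.\<close>

lemma cross_difference_far:
  assumes "L > 0" "m > 0" "condition_A L c \<alpha> K"
  obtains C where "C \<ge> 0" "\<forall>n M s. quasi_uniform_grid n L m M s \<longrightarrow>
     (\<forall>i\<in>{1..<n}. \<forall>j\<in>{1..<n}. j + 3 \<le> i \<longrightarrow>
       \<bar>cross_difference s K i j\<bar> \<le> C * (real n / real (gap i j)) powr max (4 - \<alpha>) 0)"
proof -
  define p where "p = max (4 - \<alpha>) 0"
  obtain F C where F: "F 0 = K" "\<And>k t. t \<in> {0<..<L} \<Longrightarrow> (F k has_real_derivative F (Suc k) t) (at t)"
    and C: "C \<ge> 0" "\<And>t. t \<in> {0<..<L} \<Longrightarrow> \<bar>F 4 t\<bar> \<le> C * t powr - p"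
    using condition_A_derivatives[OF assms(1,3)] unfolding p_def by metis
  show ?thesis
  proof (rule that[of "C * (4 / m) powr p"], goal_cases)
    case 1
    show ?case using C by simp
  next
    case 2
    have "\<bar>cross_difference s K i j\<bar> \<le> C * (4 / m) powr p * (real n / real (gap i j)) powr p"
      if "quasi_uniform_grid n L m M s" and ij: "i \<in> {1..<n}" "j \<in> {1..<n}" "j + 3 \<le> i" for n M s i j
    proof -
      interpret quasi_uniform_grid n L m M s by fact
      have n: "real n > 0" using n_pos by simp
      obtain t where t: "t \<in> {0<..<L}" "real (i - j - 2) * (m / real n) \<le> t" "cross_difference s (F 0) i j = F 4 t"
        by (rule cross_difference_eq_deriv4[OF ij, of F])
          (use F condition_A_continuous[OF assms(1,3)] in auto)
      have g: "real (gap i j) > 0" by (simp add: gap_def)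
      \<comment> \<open>With d = i - j \<ge> 3 this says d + 1 \<le> 4 (d - 2), an equality at d =
        3.\<close>
      have "real (gap i j) / 4 \<le> real (i - j - 2)" using ij by (simp add: gap_def field_simps of_nat_diff)
      hence "real (gap i j) / 4 * (m / real n) \<le> real (i - j - 2) * (m / real n)"
        using n m_pos by (intro mult_right_mono) auto
      hence "real (gap i j) / 4 * (m / real n) \<le> t" using t(2) by linarith
      moreover have "real (gap i j) / 4 * (m / real n) > 0" using g n m_pos by simp
      ultimately have "t powr - p \<le> (real (gap i j) / 4 * (m / real n)) powr - p"
        by (intro powr_mono2') (auto simp: p_def)
      also have "real (gap i j) / 4 * (m / real n) = inverse (4 / m * (real n / real (gap i j)))"
        by simp
      also have "\<dots> powr - p = (4 / m * (real n / real (gap i j))) powr p"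
        using g n m_pos by (subst inverse_powr) (auto simp: powr_minus)
      also have "\<dots> = (4 / m) powr p * (real n / real (gap i j)) powr p"
        using g n m_pos by (subst powr_mult) auto
      finally have "C * t powr - p \<le> C * ((4 / m) powr p * (real n / real (gap i j)) powr p)"
        using C(1) by (rule mult_left_mono)
      thus ?thesis using C(2)[OF t(1)] t(3) F(1) by (simp add: mult.assoc)
    qed
    thus ?case unfolding p_def by blast
  qed
qed

lemma cross_difference_near:
  assumes "L > 0" "m > 0" "M > 0" "condition_A L c \<alpha> K"
  obtains C N where "C \<ge> 0" "\<forall>n\<ge>N. \<forall>s. quasi_uniform_grid n L m M s \<longrightarrow>
     (\<forall>i\<in>{1..<n}. \<forall>j\<in>{1..<n}. i \<le> j + 2 \<longrightarrow> j \<le> i + 2 \<longrightarrow>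
       \<bar>cross_difference s K i j\<bar> \<le> C * (real n / real (gap i j)) powr max (4 - \<alpha>) 0)"
proof -
  have \<alpha>: "\<alpha> > 0" using assms(4) unfolding condition_A_def by simp
  define p where "p = max (4 - \<alpha>) 0"
  obtain C where C: "C \<ge> 0" and rem: "\<forall>\<epsilon>>0. \<exists>N. \<forall>n\<ge>N. \<forall>s. quasi_uniform_grid n L m M s \<longrightarrow>
     (\<forall>i\<in>{1..<n}. \<forall>j\<in>{1..<n}. i \<le> j + 2 \<longrightarrow> j \<le> i + 2 \<longrightarrow>
       \<bar>cross_difference s K i j - c * cross_difference s (\<lambda>t. \<bar>t\<bar> powr \<alpha>) i j\<bar>
         \<le> C * (\<epsilon> * real n powr (4 - \<alpha>) + 1))"
    by (rule cross_difference_remainder[OF assms])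
  obtain N where N: "\<forall>n\<ge>N. \<forall>s. quasi_uniform_grid n L m M s \<longrightarrow>
     (\<forall>i\<in>{1..<n}. \<forall>j\<in>{1..<n}. i \<le> j + 2 \<longrightarrow> j \<le> i + 2 \<longrightarrow>
       \<bar>cross_difference s K i j - c * cross_difference s (\<lambda>t. \<bar>t\<bar> powr \<alpha>) i j\<bar>
         \<le> C * (1 * real n powr (4 - \<alpha>) + 1))"
    using rem[rule_format, of 1] by auto
  define C1 where "C1 = 36 / m ^ 4 * (4 * M) powr \<alpha>"
  \<comment> \<open>\<open>C1\<close> bounds the pure power and 2 C the remainder for \<epsilon> =
    1, since 1 \<le> n^p. The factor 3^p pays for the gap, at most 3 near the diagonal.\<close>
  define C2 where "C2 = (\<bar>c\<bar> * C1 + 2 * C) * 3 powr p"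
  have C1: "C1 \<ge> 0" by (simp add: C1_def)
  show ?thesis
  proof (rule that[of C2 N], goal_cases)
    case 1
    show ?case using C C1 by (simp add: C2_def)
  next
    case 2
    have "\<bar>cross_difference s K i j\<bar> \<le> C2 * (real n / real (gap i j)) powr p"
      if "n \<ge> N" and grid: "quasi_uniform_grid n L m M s" and ij: "i \<in> {1..<n}" "j \<in> {1..<n}" "i \<le> j + 2" "j \<le> i + 2"
      for n s i j
    proof -
      interpret quasi_uniform_grid n L m M s by fact
      have n: "real n \<ge> 1" using n_pos by simp
      let ?P = "cross_difference s (\<lambda>t. \<bar>t\<bar> powr \<alpha>) i j"
      have "\<bar>?P\<bar> \<le> 36 * (real n / m) ^ 4 * (4 * (M / real n)) powr \<alpha>"
        by (rule abs_cross_difference_le[OF ij(1,2)])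
          (use abs_node_diff_le[OF ij(1,2) _ _ ij(3,4)] \<alpha> in \<open>auto intro!: powr_mono2\<close>)
      also have "\<dots> = C1 * real n powr (4 - \<alpha>)"
      proof -
        have "(4 * (M / real n)) powr \<alpha> = (4 * M) powr \<alpha> / real n powr \<alpha>"
          using n M_pos powr_divide[of "4 * M" "real n" \<alpha>] by simp
        moreover have "real n powr (4 - \<alpha>) = real n ^ 4 / real n powr \<alpha>"
          using n powr_realpow[of "real n" 4] by (simp add: powr_diff)
        ultimately show ?thesis by (simp add: C1_def power_divide)
      qed
      also have "real n powr (4 - \<alpha>) \<le> real n powr p"
        by (rule powr_mono) (use n in \<open>auto simp: p_def\<close>)
      finally have P: "\<bar>?P\<bar> \<le> C1 * real n powr p" using C1 by (simp add: mult_left_mono)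
      have "1 \<le> real n powr p" using n by (intro ge_one_powr_ge_zero) (auto simp: p_def)
      hence "C * (1 * real n powr (4 - \<alpha>) + 1) \<le> C * (2 * real n powr p)"
        using \<open>real n powr (4 - \<alpha>) \<le> real n powr p\<close> C by (intro mult_left_mono) auto
      hence "\<bar>cross_difference s K i j - c * ?P\<bar> \<le> 2 * C * real n powr p"
        using N[rule_format, OF that(1) grid ij] by simp
      moreover have "\<bar>c * ?P\<bar> \<le> \<bar>c\<bar> * (C1 * real n powr p)"
        unfolding abs_mult using P by (rule mult_left_mono) simp
      ultimately have "\<bar>cross_difference s K i j\<bar> \<le> (\<bar>c\<bar> * C1 + 2 * C) * real n powr p"
        unfolding distrib_right by (simp add: mult.assoc)
      also have "real n powr p \<le> (3 * (real n / real (gap i j))) powr p"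
      proof (rule powr_mono2)
        have "0 < real (gap i j)" "real (gap i j) \<le> 3" using ij by (auto simp: gap_def)
        thus "real n \<le> 3 * (real n / real (gap i j))" using n by (simp add: field_simps)
      qed (auto simp: p_def)
      also have "\<dots> = 3 powr p * (real n / real (gap i j)) powr p"
        by (rule powr_mult)
      finally show ?thesis using C C1 by (simp add: C2_def mult.assoc mult_left_mono)
    qed
    thus ?case unfolding p_def by blast
  qed
qed

text \<open>Evenness of \<open>K\<close> carries the far bound from one side of the diagonal to the
  other.\<close>

lemma cross_difference_upper:
  assumes "L > 0" "m > 0" "M > 0" "condition_A L c \<alpha> K"
  obtains C N where "C \<ge> 0" "\<forall>n\<ge>N. \<forall>s. quasi_uniform_grid n L m M s \<longrightarrow>
     (\<forall>i\<in>{1..<n}. \<forall>j\<in>{1..<n}.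
       \<bar>cross_difference s K i j\<bar> \<le> C * (real n / real (gap i j)) powr max (4 - \<alpha>) 0)"
proof -
  obtain C1 N where C1: "C1 \<ge> 0" and near: "\<forall>n\<ge>N. \<forall>s. quasi_uniform_grid n L m M s \<longrightarrow>
     (\<forall>i\<in>{1..<n}. \<forall>j\<in>{1..<n}. i \<le> j + 2 \<longrightarrow> j \<le> i + 2 \<longrightarrow>
       \<bar>cross_difference s K i j\<bar> \<le> C1 * (real n / real (gap i j)) powr max (4 - \<alpha>) 0)"
    by (rule cross_difference_near[OF assms])
  obtain C2 where C2: "C2 \<ge> 0" and far: "\<forall>n M s. quasi_uniform_grid n L m M s \<longrightarrow>
     (\<forall>i\<in>{1..<n}. \<forall>j\<in>{1..<n}. j + 3 \<le> i \<longrightarrow>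
       \<bar>cross_difference s K i j\<bar> \<le> C2 * (real n / real (gap i j)) powr max (4 - \<alpha>) 0)"
    by (rule cross_difference_far[OF assms(1,2,4)])
  show ?thesis
  proof (rule that[of "C1 + C2" N], goal_cases)
    case 1
    show ?case using C1 C2 by simp
  next
    case 2
    have "\<bar>cross_difference s K i j\<bar> \<le> (C1 + C2) * (real n / real (gap i j)) powr max (4 - \<alpha>) 0"
      if "n \<ge> N" and grid: "quasi_uniform_grid n L m M s" and ij: "i \<in> {1..<n}" "j \<in> {1..<n}" for n s i j
    proof -
      interpret quasi_uniform_grid n L m M s by fact
      let ?g = "(real n / real (gap i j)) powr max (4 - \<alpha>) 0"
      have nn: "0 \<le> C1 * ?g" "0 \<le> C2 * ?g" using C1 C2 by auto
      have "K (s k - s l) = K (s l - s k)" if "k \<in> stencil i" "l \<in> stencil j" for k l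
        using condition_A_even[OF assms(4) node_diff_mem[OF ij that]] by simp
      hence swap: "cross_difference s K i j = cross_difference s K j i"
        using ij by (intro cross_difference_swap) auto
      consider "i \<le> j + 2 \<and> j \<le> i + 2" | "j + 3 \<le> i" | "i + 3 \<le> j" by linarith
      thus ?thesis
      proof cases
        case 1
        with near[rule_format, OF that(1) grid ij] nn show ?thesis unfolding distrib_right by linarith
      next
        case 2
        with far[rule_format, OF grid ij] nn show ?thesis unfolding distrib_right by linarith
      next
        case 3
        with far[rule_format, OF grid ij(2,1)] nn swap show ?thesis
          unfolding distrib_right gap_commute[of j i] by linarith
      qed
    qed
    thus ?case by blast
  qed
qed

text \<open>The pure power contributes at least |c| \<kappa>0 n^(4-\<alpha>), and the remainder is a
  small multiple of n^(4-\<alpha>) plus O(1). As \<alpha> < 4, the O(1) is eventually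
  dominated.\<close>

lemma cross_difference_diagonal_lower:
  assumes "L > 0" "m > 0" "M > 0" "condition_A L c \<alpha> K" "\<alpha> < 4" "\<alpha> \<noteq> 2" "c \<noteq> 0"
  obtains \<kappa> N where "\<kappa> > 0" "\<forall>n\<ge>N. \<forall>s. quasi_uniform_grid n L m M s \<longrightarrow>
     (\<forall>i\<in>{1..<n}. \<kappa> * real n powr (4 - \<alpha>) \<le> \<bar>cross_difference s K i i\<bar>)"
proof -
  have \<alpha>: "\<alpha> > 0" using assms(4) unfolding condition_A_def by simp
  obtain C where C: "C \<ge> 0" and rem: "\<forall>\<epsilon>>0. \<exists>N. \<forall>n\<ge>N. \<forall>s. quasi_uniform_grid n L m M s \<longrightarrow>
     (\<forall>i\<in>{1..<n}. \<forall>j\<in>{1..<n}. i \<le> j + 2 \<longrightarrow> j \<le> i + 2 \<longrightarrow>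
       \<bar>cross_difference s K i j - c * cross_difference s (\<lambda>t. \<bar>t\<bar> powr \<alpha>) i j\<bar>
         \<le> C * (\<epsilon> * real n powr (4 - \<alpha>) + 1))"
    by (rule cross_difference_remainder[OF assms(1-4)])
  obtain \<kappa>0 where \<kappa>0: "\<kappa>0 > 0" and low:
    "\<And>n L s i. quasi_uniform_grid n L m M s \<Longrightarrow> i \<in> {1..<n} \<Longrightarrow>
      \<kappa>0 * real n powr (4 - \<alpha>) \<le> \<bar>cross_difference s (\<lambda>t. \<bar>t\<bar> powr \<alpha>) i i\<bar>"
    using cross_difference_powr_lower[OF assms(2) \<alpha> assms(6)] by metis
  \<comment> \<open>In units of \<kappa> n^(4-\<alpha>) the pure power counts at least 4 and the two
    parts of the remainder at most 1 each.\<close>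
  define \<kappa> where "\<kappa> = \<bar>c\<bar> * \<kappa>0 / 4"
  have \<kappa>: "\<kappa> > 0" using \<kappa>0 assms(7) by (simp add: \<kappa>_def)
  define \<epsilon> where "\<epsilon> = \<kappa> / (C + 1)"
  have \<epsilon>: "\<epsilon> > 0" "C * \<epsilon> \<le> \<kappa>" using \<kappa> C by (auto simp: \<epsilon>_def field_simps)
  obtain N where N: "\<forall>n\<ge>N. \<forall>s. quasi_uniform_grid n L m M s \<longrightarrow>
     (\<forall>i\<in>{1..<n}. \<forall>j\<in>{1..<n}. i \<le> j + 2 \<longrightarrow> j \<le> i + 2 \<longrightarrow>
       \<bar>cross_difference s K i j - c * cross_difference s (\<lambda>t. \<bar>t\<bar> powr \<alpha>) i j\<bar>
         \<le> C * (\<epsilon> * real n powr (4 - \<alpha>) + 1))"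
    using rem[rule_format, OF \<epsilon>(1)] by blast
  have "(\<lambda>n. C * real n powr (\<alpha> - 4)) \<longlonglongrightarrow> 0"
    by (intro tendsto_mult_right_zero tendsto_neg_powr filterlim_real_sequentially) (use assms(5) in auto)
  hence "eventually (\<lambda>n. C * real n powr (\<alpha> - 4) < \<kappa>) sequentially"
    using \<kappa> by (rule order_tendstoD)
  then obtain N' where N': "\<And>n. n \<ge> N' \<Longrightarrow> C * real n powr (\<alpha> - 4) < \<kappa>"
    unfolding eventually_sequentially by blast
  show ?thesis
  proof (rule that[of \<kappa> "max N N'"], goal_cases)
    case 1
    show ?case by (rule \<kappa>)
  next
    case 2
    have "\<kappa> * real n powr (4 - \<alpha>) \<le> \<bar>cross_difference s K i i\<bar>"
      if "n \<ge> max N N'" and grid: "quasi_uniform_grid n L m M s" and i: "i \<in> {1..<n}" for n s i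
    proof -
      let ?P = "cross_difference s (\<lambda>t. \<bar>t\<bar> powr \<alpha>) i i"
      let ?n = "real n powr (4 - \<alpha>)"
      have "\<bar>c\<bar> * (\<kappa>0 * ?n) \<le> \<bar>c * ?P\<bar>"
        unfolding abs_mult using low[OF grid i] by (rule mult_left_mono) simp
      hence 1: "4 * (\<kappa> * ?n) \<le> \<bar>c * ?P\<bar>" by (simp add: \<kappa>_def mult.assoc)
      have 2: "\<bar>cross_difference s K i i - c * ?P\<bar> \<le> C * (\<epsilon> * ?n + 1)"
        using N grid i that(1) by simp
      have "C * real n powr (\<alpha> - 4) * ?n \<le> \<kappa> * ?n"
        by (rule mult_right_mono) (use N'[of n] that(1) in auto)
      moreover have "real n powr (\<alpha> - 4) * ?n = 1" using i by (simp flip: powr_add)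
      ultimately have 3: "C \<le> \<kappa> * ?n" by (simp add: mult.assoc)
      have "C * \<epsilon> * ?n \<le> \<kappa> * ?n" using \<epsilon>(2) by (rule mult_right_mono) simp
      hence "C * (\<epsilon> * ?n + 1) \<le> 2 * (\<kappa> * ?n)" using 3 by (simp add: distrib_left)
      moreover have "0 \<le> \<kappa> * ?n" using \<kappa> by simp
      ultimately show ?thesis using 1 2 by linarith
    qed
    thus ?case by blast
  qed
qed

section \<open>Ratios of quadratic forms in Gaussian variables\<close>

context centered_gaussian_space
begin

text \<open>Of the three pairings for each (i, j), the one staying within i and within j sums to the
  square of the mean. The identity serves the numerator, and with w = u the denominator.\<close>

lemma expectation_sum_products_square:
  assumes "finite I" and u: "\<And>i. i \<in> I \<Longrightarrow> u i \<in> H" and w: "\<And>i. i \<in> I \<Longrightarrow> w i \<in> H"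
  shows integrable_sum_products_square: "integrable M (\<lambda>\<omega>. (\<Sum>i\<in>I. u i \<omega> * w i \<omega>)\<^sup>2)"
    and "expectation (\<lambda>\<omega>. (\<Sum>i\<in>I. u i \<omega> * w i \<omega>)\<^sup>2) =
      (\<Sum>i\<in>I. expectation (\<lambda>\<omega>. u i \<omega> * w i \<omega>))\<^sup>2 +
      (\<Sum>i\<in>I. \<Sum>j\<in>I. expectation (\<lambda>\<omega>. u i \<omega> * u j \<omega>) * expectation (\<lambda>\<omega>. w i \<omega> * w j \<omega>) +
        expectation (\<lambda>\<omega>. u i \<omega> * w j \<omega>) * expectation (\<lambda>\<omega>. w i \<omega> * u j \<omega>))"
proof -
  have eq: "(\<lambda>\<omega>. (\<Sum>i\<in>I. u i \<omega> * w i \<omega>)\<^sup>2) = (\<lambda>\<omega>. \<Sum>i\<in>I. \<Sum>j\<in>I. u i \<omega> * w i \<omega> * (u j \<omega> * w j \<omega>))"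
    by (simp add: power2_eq_square sum_product)
  note int = integrable_product4[OF u w u w]
  show "integrable M (\<lambda>\<omega>. (\<Sum>i\<in>I. u i \<omega> * w i \<omega>)\<^sup>2)"
    unfolding eq by (intro Bochner_Integration.integrable_sum int)
  have "expectation (\<lambda>\<omega>. (\<Sum>i\<in>I. u i \<omega> * w i \<omega>)\<^sup>2) =
    (\<Sum>i\<in>I. \<Sum>j\<in>I. expectation (\<lambda>\<omega>. u i \<omega> * w i \<omega> * (u j \<omega> * w j \<omega>)))"
    unfolding eq
    by (subst Bochner_Integration.integral_sum, intro Bochner_Integration.integrable_sum int, assumption+)
      (intro sum.cong refl Bochner_Integration.integral_sum int)
  also have "\<dots> = (\<Sum>i\<in>I. \<Sum>j\<in>I. expectation (\<lambda>\<omega>. u i \<omega> * w i \<omega>) * expectation (\<lambda>\<omega>. u j \<omega> * w j \<omega>) +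
      (expectation (\<lambda>\<omega>. u i \<omega> * u j \<omega>) * expectation (\<lambda>\<omega>. w i \<omega> * w j \<omega>) +
        expectation (\<lambda>\<omega>. u i \<omega> * w j \<omega>) * expectation (\<lambda>\<omega>. w i \<omega> * u j \<omega>)))"
    by (intro sum.cong refl) (simp add: expectation_product4 u w)
  also have "\<dots> = (\<Sum>i\<in>I. expectation (\<lambda>\<omega>. u i \<omega> * w i \<omega>))\<^sup>2 +
      (\<Sum>i\<in>I. \<Sum>j\<in>I. expectation (\<lambda>\<omega>. u i \<omega> * u j \<omega>) * expectation (\<lambda>\<omega>. w i \<omega> * w j \<omega>) +
        expectation (\<lambda>\<omega>. u i \<omega> * w j \<omega>) * expectation (\<lambda>\<omega>. w i \<omega> * u j \<omega>))"
    by (simp add: sum.distrib power2_eq_square sum_product)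
  finally show "expectation (\<lambda>\<omega>. (\<Sum>i\<in>I. u i \<omega> * w i \<omega>)\<^sup>2) =
      (\<Sum>i\<in>I. expectation (\<lambda>\<omega>. u i \<omega> * w i \<omega>))\<^sup>2 +
      (\<Sum>i\<in>I. \<Sum>j\<in>I. expectation (\<lambda>\<omega>. u i \<omega> * u j \<omega>) * expectation (\<lambda>\<omega>. w i \<omega> * w j \<omega>) +
        expectation (\<lambda>\<omega>. u i \<omega> * w j \<omega>) * expectation (\<lambda>\<omega>. w i \<omega> * u j \<omega>))" .
qed

text \<open>For w = u the two pairings across i and j coincide, whence the factor 2; centring
  removes the remaining one.\<close>

lemma expectation_centered_sum_squares:
  assumes "finite I" and u: "\<And>i. i \<in> I \<Longrightarrow> u i \<in> H"
  defines "d \<equiv> \<Sum>i\<in>I. expectation (\<lambda>\<omega>. (u i \<omega>)\<^sup>2)"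
  shows "integrable M (\<lambda>\<omega>. ((\<Sum>i\<in>I. (u i \<omega>)\<^sup>2) - d)\<^sup>2)"
    and "expectation (\<lambda>\<omega>. ((\<Sum>i\<in>I. (u i \<omega>)\<^sup>2) - d)\<^sup>2) =
      2 * (\<Sum>i\<in>I. \<Sum>j\<in>I. (expectation (\<lambda>\<omega>. u i \<omega> * u j \<omega>))\<^sup>2)"
proof -
  let ?D = "\<lambda>\<omega>. \<Sum>i\<in>I. (u i \<omega>)\<^sup>2"
  have D2: "integrable M (\<lambda>\<omega>. (?D \<omega>)\<^sup>2)"
    "expectation (\<lambda>\<omega>. (?D \<omega>)\<^sup>2) = d\<^sup>2 + 2 * (\<Sum>i\<in>I. \<Sum>j\<in>I. (expectation (\<lambda>\<omega>. u i \<omega> * u j \<omega>))\<^sup>2)"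
    using expectation_sum_products_square[OF assms(1) u u]
    by (simp_all add: d_def power2_eq_square sum_distrib_left)
  have D: "integrable M ?D"
    by (intro Bochner_Integration.integrable_sum integrable_power u)
  have ED: "expectation ?D = d"
    unfolding d_def by (intro Bochner_Integration.integral_sum integrable_power u)
  have eq: "(\<lambda>\<omega>. (?D \<omega> - d)\<^sup>2) = (\<lambda>\<omega>. (?D \<omega>)\<^sup>2 - 2 * d * ?D \<omega> + d\<^sup>2)"
    by (rule ext) (simp only: power2_diff, simp add: mult_ac)
  show "integrable M (\<lambda>\<omega>. (?D \<omega> - d)\<^sup>2)" unfolding eq using D2 D by auto
  show "expectation (\<lambda>\<omega>. (?D \<omega> - d)\<^sup>2) =
      2 * (\<Sum>i\<in>I. \<Sum>j\<in>I. (expectation (\<lambda>\<omega>. u i \<omega> * u j \<omega>))\<^sup>2)"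
    unfolding eq using D2 D by (simp add: ED prob_space) (simp add: power2_eq_square)
qed

text \<open>Chebyshev's inequality, once for the denominator to exceed half its mean and once for the
  numerator.\<close>

lemma prob_ratio_le:
  assumes I: "finite I" and u: "\<And>i. i \<in> I \<Longrightarrow> u i \<in> H" and w: "\<And>i. i \<in> I \<Longrightarrow> w i \<in> H"
    and d: "d = (\<Sum>i\<in>I. expectation (\<lambda>\<omega>. (u i \<omega>)\<^sup>2))" "d > 0" and \<epsilon>: "\<epsilon> > 0"
    and A: "A \<subseteq> {\<omega> \<in> space M. (\<Sum>i\<in>I. (u i \<omega>)\<^sup>2) > 0 \<longrightarrow>
      \<bar>\<Sum>i\<in>I. u i \<omega> * w i \<omega>\<bar> > \<epsilon> * (\<Sum>i\<in>I. (u i \<omega>)\<^sup>2)}"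
  shows "prob A \<le> 4 / d\<^sup>2 * (expectation (\<lambda>\<omega>. ((\<Sum>i\<in>I. (u i \<omega>)\<^sup>2) - d)\<^sup>2) +
      expectation (\<lambda>\<omega>. (\<Sum>i\<in>I. u i \<omega> * w i \<omega>)\<^sup>2) / \<epsilon>\<^sup>2)"
proof -
  let ?D = "\<lambda>\<omega>. \<Sum>i\<in>I. (u i \<omega>)\<^sup>2"
  let ?N = "\<lambda>\<omega>. \<Sum>i\<in>I. u i \<omega> * w i \<omega>"
  have [measurable]: "i \<in> I \<Longrightarrow> u i \<in> borel_measurable M" "i \<in> I \<Longrightarrow> w i \<in> borel_measurable M" for i
    using u w measurable by auto
  have [measurable]: "?D \<in> borel_measurable M" "?N \<in> borel_measurable M"
    by measurable
  define A1 where "A1 = {\<omega> \<in> space M. (?D \<omega> - d)\<^sup>2 \<ge> (d / 2)\<^sup>2}"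
  define A2 where "A2 = {\<omega> \<in> space M. (?N \<omega>)\<^sup>2 \<ge> (\<epsilon> * d / 2)\<^sup>2}"
  have sets: "A1 \<in> events" "A2 \<in> events" unfolding A1_def A2_def by measurable
  have "A \<subseteq> A1 \<union> A2"
  proof
    fix \<omega> assume "\<omega> \<in> A"
    hence \<omega>: "\<omega> \<in> space M" and imp: "?D \<omega> > 0 \<Longrightarrow> \<bar>?N \<omega>\<bar> > \<epsilon> * ?D \<omega>" using A by auto
    show "\<omega> \<in> A1 \<union> A2"
    \<comment> \<open>Outcomes with vanishing denominator belong to this first case, hence to
      \<open>A1\<close>, so the value of a quotient by 0 never matters.\<close>
    proof (cases "?D \<omega> \<le> d / 2")
      case True
      hence "\<bar>d / 2\<bar> \<le> \<bar>?D \<omega> - d\<bar>" using d(2) by simp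
      thus ?thesis using \<omega> unfolding A1_def abs_le_square_iff by simp
    next
      case False
      hence "?D \<omega> > 0" using d(2) by simp
      have "\<epsilon> * (d / 2) \<le> \<epsilon> * ?D \<omega>" using False \<epsilon> by (intro mult_left_mono) auto
      hence "\<epsilon> * d / 2 \<le> \<bar>?N \<omega>\<bar>" using imp[OF \<open>?D \<omega> > 0\<close>] by linarith
      moreover have "\<bar>\<epsilon> * d / 2\<bar> = \<epsilon> * d / 2" using \<epsilon> d(2) by simp
      ultimately have "\<bar>\<epsilon> * d / 2\<bar> \<le> \<bar>?N \<omega>\<bar>" by linarith
      thus ?thesis using \<omega> unfolding A2_def abs_le_square_iff by simp
    qed
  qed
  \<comment> \<open>Monotonicity asks for measurability of the larger set only.\<close>
  hence "prob A \<le> prob (A1 \<union> A2)" using sets by (intro finite_measure_mono) auto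
  also have "\<dots> \<le> prob A1 + prob A2" using sets by (rule measure_Un_le)
  also have "prob A1 \<le> expectation (\<lambda>\<omega>. (?D \<omega> - d)\<^sup>2) / (d / 2)\<^sup>2"
    unfolding A1_def
    by (rule integral_Markov_inequality_measure[where A = "{}"])
      (use expectation_centered_sum_squares(1)[OF I u] d in auto)
  also have "prob A2 \<le> expectation (\<lambda>\<omega>. (?N \<omega>)\<^sup>2) / (\<epsilon> * d / 2)\<^sup>2"
    unfolding A2_def
    by (rule integral_Markov_inequality_measure[where A = "{}"])
      (use integrable_sum_products_square[OF I u w] d \<epsilon> in auto)
  finally show ?thesis using d(2) \<epsilon> by (simp add: field_simps power2_eq_square)
qed

end

section \<open>The linear span of the field as a Gaussian space\<close>

definition field_span :: "('t \<Rightarrow> 'w \<Rightarrow> real ^ 'k) \<Rightarrow> ('w \<Rightarrow> real) set" where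
  "field_span Z = {U. \<exists>F a. finite F \<and> U = (\<lambda>\<omega>. \<Sum>s\<in>F. a s \<bullet> Z s \<omega>)}"

lemma field_span_add:
  assumes "U \<in> field_span Z" "V \<in> field_span Z"
  shows "(\<lambda>\<omega>. U \<omega> + V \<omega>) \<in> field_span Z"
proof -
  obtain F a where F: "finite F" "U = (\<lambda>\<omega>. \<Sum>s\<in>F. a s \<bullet> Z s \<omega>)"
    using assms(1) unfolding field_span_def by blast
  obtain G b where G: "finite G" "V = (\<lambda>\<omega>. \<Sum>s\<in>G. b s \<bullet> Z s \<omega>)"
    using assms(2) unfolding field_span_def by blast
  define a' where "a' = (\<lambda>s. if s \<in> F then a s else 0)"
  define b' where "b' = (\<lambda>s. if s \<in> G then b s else 0)"
  have "U \<omega> + V \<omega> = (\<Sum>s\<in>F \<union> G. (a' s + b' s) \<bullet> Z s \<omega>)" for \<omega>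
  proof -
    have "U \<omega> = (\<Sum>s\<in>F \<union> G. a' s \<bullet> Z s \<omega>)" unfolding F(2)
      by (rule sum.mono_neutral_cong_left) (use F G in \<open>auto simp: a'_def\<close>)
    moreover have "V \<omega> = (\<Sum>s\<in>F \<union> G. b' s \<bullet> Z s \<omega>)" unfolding G(2)
      by (rule sum.mono_neutral_cong_left) (use F G in \<open>auto simp: b'_def\<close>)
    ultimately show ?thesis by (simp add: inner_add_left sum.distrib)
  qed
  thus ?thesis unfolding field_span_def using F(1) G(1)
    by (intro CollectI exI[of _ "F \<union> G"] exI[of _ "\<lambda>s. a' s + b' s"]) auto
qed

lemma field_span_scale:
  assumes "U \<in> field_span Z"
  shows "(\<lambda>\<omega>. c * U \<omega>) \<in> field_span Z"
proof -
  obtain F a where F: "finite F" "U = (\<lambda>\<omega>. \<Sum>s\<in>F. a s \<bullet> Z s \<omega>)"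
    using assms unfolding field_span_def by blast
  thus ?thesis unfolding field_span_def
    by (intro CollectI exI[of _ F] exI[of _ "\<lambda>s. c *\<^sub>R a s"]) (simp add: sum_distrib_left)
qed

lemma field_span_component: "(\<lambda>\<omega>. Z t \<omega> $ k) \<in> field_span Z"
  unfolding field_span_def
  by (intro CollectI exI[of _ "{t}"] exI[of _ "\<lambda>_. axis k 1"]) (simp add: inner_axis')

lemma field_span_sum:
  assumes "finite I" "\<And>i. i \<in> I \<Longrightarrow> U i \<in> field_span Z"
  shows "(\<lambda>\<omega>. \<Sum>i\<in>I. U i \<omega>) \<in> field_span Z"
  using assms
proof (induction I rule: finite_induct)
  case empty
  show ?case unfolding field_span_def by (intro CollectI exI[of _ "{}"]) simp
next
  case (insert i I)
  thus ?case by (simp add: field_span_add)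
qed

lemma integrable_normal_rv:
  assumes "prob_space M" "normal_rv M U"
  shows "integrable M U"
proof -
  interpret prob_space M by fact
  have "integrable M (\<lambda>\<omega>. (U \<omega> - integral\<^sup>L M U) ^ 1 + integral\<^sup>L M U)"
    using integrable_normal_rv_central_moment[OF assms, of 1] by (intro Bochner_Integration.integrable_add) auto
  thus ?thesis by simp
qed

text \<open>Restriction to mean zero is harmless: second differences annihilate the constant mean of
  the field and so lie in this subspace.\<close>

lemma centered_gaussian_space_field_span:
  assumes "prob_space M" "gaussian_field M Z"
  shows "centered_gaussian_space M {U \<in> field_span Z. integral\<^sup>L M U = 0}"
proof -
  have normal: "normal_rv M U" if "U \<in> field_span Z" for U
    using assms(2) that unfolding gaussian_field_def field_span_def by blast
  note int = integrable_normal_rv[OF assms(1) normal]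
  interpret prob_space M by fact
  show ?thesis
    by unfold_locales (auto simp: field_span_add field_span_scale normal int)
qed

lemma second_difference_const: "second_difference s (\<lambda>t. a) i = 0"
  by (simp add: second_difference_def)

lemma second_difference_mem_field_span:
  assumes "i \<ge> 1"
  shows "(\<lambda>\<omega>. second_difference s (\<lambda>t. Z t \<omega> $ k) i) \<in> field_span Z"
  unfolding second_difference_eq_sum[OF assms]
  by (intro field_span_sum field_span_scale field_span_component) simp

text \<open>The weights sum to 0, so the mean of the field may be subtracted at every node; then the
  covariance is expanded bilinearly.\<close>

lemma second_difference_moments:
  fixes Z :: "real \<Rightarrow> 'w \<Rightarrow> real ^ 'k"
  assumes Z: "stationary_gaussian_field M Z K" and ij: "i \<ge> 1" "j \<ge> 1"
  shows expectation_second_difference: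
      "(\<integral>\<omega>. second_difference s (\<lambda>t. Z t \<omega> $ k) i \<partial>M) = 0"
    and expectation_second_difference_product:
      "(\<integral>\<omega>. second_difference s (\<lambda>t. Z t \<omega> $ k) i * second_difference s (\<lambda>t. Z t \<omega> $ l) j \<partial>M) =
        cross_difference s (\<lambda>t. K t $ k $ l) i j"
proof -
  have P: "prob_space M" and G: "gaussian_field M Z"
    and cov: "\<And>s t k l. cov M (\<lambda>\<omega>. Z (s + t) \<omega> $ k) (\<lambda>\<omega>. Z s \<omega> $ l) = K t $ k $ l"
    using Z unfolding stationary_gaussian_field_def by auto
  obtain \<mu> where \<mu>: "\<And>s k. integral\<^sup>L M (\<lambda>\<omega>. Z s \<omega> $ k) = \<mu> $ k"
    using Z unfolding stationary_gaussian_field_def by blast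
  interpret prob_space M by (rule P)
  have normal: "normal_rv M U" if "U \<in> field_span Z" for U
    using G that unfolding gaussian_field_def field_span_def by blast
  note normal_comp = normal[OF field_span_component]
  have int: "integrable M (\<lambda>\<omega>. Z t \<omega> $ k)" for t k
    by (rule integrable_normal_rv[OF P normal_comp])
  have meas [measurable]: "(\<lambda>\<omega>. Z t \<omega> $ k) \<in> borel_measurable M" for t k
    using int by (rule borel_measurable_integrable)
  have sq: "integrable M (\<lambda>\<omega>. (Z t \<omega> $ k - \<mu> $ k)\<^sup>2)" for t k
    using integrable_normal_rv_central_moment[OF P normal_comp, of t k 2] by (simp add: \<mu>)
  have prod: "integrable M (\<lambda>\<omega>. (Z t \<omega> $ k - \<mu> $ k) * (Z t' \<omega> $ l - \<mu> $ l))" for t t' k l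
  proof (rule Bochner_Integration.integrable_bound)
    show "integrable M (\<lambda>\<omega>. (Z t \<omega> $ k - \<mu> $ k)\<^sup>2 + (Z t' \<omega> $ l - \<mu> $ l)\<^sup>2)"
      using sq by (intro Bochner_Integration.integrable_add)
    have "\<bar>x * y\<bar> \<le> x\<^sup>2 + y\<^sup>2" for x y :: real
    proof -
      have "2 * (\<bar>x\<bar> * \<bar>y\<bar>) \<le> x\<^sup>2 + y\<^sup>2" using sum_squares_bound[of "\<bar>x\<bar>" "\<bar>y\<bar>"] by simp
      moreover have "0 \<le> \<bar>x\<bar> * \<bar>y\<bar>" by simp
      ultimately show ?thesis unfolding abs_mult by linarith
    qed
    thus "AE \<omega> in M. norm ((Z t \<omega> $ k - \<mu> $ k) * (Z t' \<omega> $ l - \<mu> $ l))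
        \<le> norm ((Z t \<omega> $ k - \<mu> $ k)\<^sup>2 + (Z t' \<omega> $ l - \<mu> $ l)\<^sup>2)"
      by simp
  qed measurable
  \<comment> \<open>\<open>K t\<close> pairs the component at s + t with the one at s. The argument
    is thus the first time minus the second, the orientation of \<open>K (x - y)\<close> in
    \<open>cross_difference\<close>.\<close>
  have exp: "expectation (\<lambda>\<omega>. (Z t \<omega> $ k - \<mu> $ k) * (Z t' \<omega> $ l - \<mu> $ l)) = K (t - t') $ k $ l" for t t' k l
    using cov[of t' "t - t'" k l] by (simp add: cov_def \<mu>)
  have mean0: "(\<Sum>a\<in>stencil i. sd_weight s i a * c) = 0" if "i \<ge> 1" for i c
    using second_difference_eq_sum[OF that, of s "\<lambda>_. c"] by (simp add: second_difference_const)
  show "(\<integral>\<omega>. second_difference s (\<lambda>t. Z t \<omega> $ k) i \<partial>M) = 0"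
    unfolding second_difference_eq_sum[OF ij(1)]
    by (subst Bochner_Integration.integral_sum) (auto simp: int \<mu> mean0[OF ij(1)])
  have centered: "second_difference s (\<lambda>t. Z t \<omega> $ k) i = (\<Sum>a\<in>stencil i. sd_weight s i a * (Z (s a) \<omega> $ k - \<mu> $ k))"
    if "i \<ge> 1" for i k \<omega>
    unfolding second_difference_eq_sum[OF that] right_diff_distrib sum_subtractf mean0[OF that] by simp
  have "(\<lambda>\<omega>. second_difference s (\<lambda>t. Z t \<omega> $ k) i * second_difference s (\<lambda>t. Z t \<omega> $ l) j) =
     (\<lambda>\<omega>. \<Sum>a\<in>stencil i. \<Sum>b\<in>stencil j. sd_weight s i a * sd_weight s j b *
       ((Z (s a) \<omega> $ k - \<mu> $ k) * (Z (s b) \<omega> $ l - \<mu> $ l)))"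
    unfolding centered[OF ij(1)] centered[OF ij(2)] sum_product
    by (intro ext sum.cong refl) (simp only: mult_ac)
  hence "(\<integral>\<omega>. second_difference s (\<lambda>t. Z t \<omega> $ k) i * second_difference s (\<lambda>t. Z t \<omega> $ l) j \<partial>M) =
    (\<integral>\<omega>. (\<Sum>a\<in>stencil i. \<Sum>b\<in>stencil j. sd_weight s i a * sd_weight s j b *
       ((Z (s a) \<omega> $ k - \<mu> $ k) * (Z (s b) \<omega> $ l - \<mu> $ l))) \<partial>M)" by simp
  also have "\<dots> = (\<Sum>a\<in>stencil i. \<Sum>b\<in>stencil j. sd_weight s i a * sd_weight s j b *
       K (s a - s b) $ k $ l)"
    using prod by (simp add: exp)
  finally show "(\<integral>\<omega>. second_difference s (\<lambda>t. Z t \<omega> $ k) i * second_difference s (\<lambda>t. Z t \<omega> $ l) j \<partial>M) =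
        cross_difference s (\<lambda>t. K t $ k $ l) i j"
    unfolding cross_difference_eq_sum[OF ij] .
qed

section \<open>Convergence of the estimator\<close>

lemma sum_gap_powr_le:
  assumes "n \<ge> 1"
  shows "(\<Sum>i\<in>{1..<n}. \<Sum>j\<in>{1..<n}. (real n / real (gap i j)) powr q) \<le>
    2 * real n powr (1 + q) * (\<Sum>k=1..n. real k powr - q)"
proof -
  have eq: "{1..<n} = {1..n - 1}" using assms by auto
  have "(real n / real (gap i j)) powr q = real n powr q * real (gap i j) powr - q" for i j
    by (simp add: powr_divide powr_minus_divide)
  hence "(\<Sum>i\<in>{1..<n}. \<Sum>j\<in>{1..<n}. (real n / real (gap i j)) powr q) =
      real n powr q * (\<Sum>i=1..n - 1. \<Sum>j=1..n - 1. real (gap i j) powr - q)"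
    unfolding eq by (simp add: sum_distrib_left)
  also have "(\<Sum>i=1..n - 1. \<Sum>j=1..n - 1. real (gap i j) powr - q) \<le>
      2 * real (n - 1) * (\<Sum>k=1..n - 1. real k powr - q)"
    unfolding gap_def by (rule double_sum_gap_le) simp
  also have "\<dots> \<le> 2 * real n * (\<Sum>k=1..n. real k powr - q)"
    by (intro mult_mono sum_mono2) (auto intro!: sum_nonneg)
  also have "real n powr q * (2 * real n * (\<Sum>k=1..n. real k powr - q)) =
      2 * real n powr (1 + q) * (\<Sum>k=1..n. real k powr - q)"
    using assms by (simp add: powr_add)
  finally show ?thesis by (simp add: mult_left_mono)
qed

lemma square_le_if_abs_le:
  fixes x y :: real
  assumes "\<bar>x\<bar> \<le> y"
  shows "x\<^sup>2 \<le> y\<^sup>2"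
  using power_mono[OF assms, of 2] by simp

text \<open>A bound for fixed n whose three terms are the variance of the denominator, the pairings
  between u and w, and the pairing of u with u and w with w, each divided by the order of the
  squared mean of the denominator.\<close>

lemma (in centered_gaussian_space) prob_ratio_le_gap:
  assumes n: "n \<ge> 2"
    and u: "\<And>i. i \<in> {1..<n} \<Longrightarrow> u i \<in> H" and w: "\<And>i. i \<in> {1..<n} \<Longrightarrow> w i \<in> H"
    and uu: "\<And>i j. i \<in> {1..<n} \<Longrightarrow> j \<in> {1..<n} \<Longrightarrow>
      \<bar>expectation (\<lambda>\<omega>. u i \<omega> * u j \<omega>)\<bar> \<le> C1 * (real n / real (gap i j)) powr p1"
    and ww: "\<And>i j. i \<in> {1..<n} \<Longrightarrow> j \<in> {1..<n} \<Longrightarrow>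
      \<bar>expectation (\<lambda>\<omega>. w i \<omega> * w j \<omega>)\<bar> \<le> C2 * (real n / real (gap i j)) powr p2"
    and uw: "\<And>i j. i \<in> {1..<n} \<Longrightarrow> j \<in> {1..<n} \<Longrightarrow>
      \<bar>expectation (\<lambda>\<omega>. u i \<omega> * w j \<omega>)\<bar> \<le> C3 * (real n / real (gap i j)) powr p3"
    and low: "\<And>i. i \<in> {1..<n} \<Longrightarrow> \<kappa> * real n powr p1 \<le> expectation (\<lambda>\<omega>. (u i \<omega>)\<^sup>2)"
    and pos: "\<kappa> > 0" "\<epsilon> > 0" "C1 \<ge> 0" "C2 \<ge> 0" "C3 \<ge> 0" "p3 \<ge> 0"
    and A: "A \<subseteq> {\<omega> \<in> space M. (\<Sum>i\<in>{1..<n}. (u i \<omega>)\<^sup>2) > 0 \<longrightarrow>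
      \<bar>\<Sum>i\<in>{1..<n}. u i \<omega> * w i \<omega>\<bar> > \<epsilon> * (\<Sum>i\<in>{1..<n}. (u i \<omega>)\<^sup>2)}"
  shows "prob A \<le> 16 / \<kappa>\<^sup>2 * (4 * C1\<^sup>2 * (real n powr - 1 * (\<Sum>k=1..n. real k powr - (2 * p1))) +
      (2 * C3\<^sup>2 * real n powr - (2 * (p1 - p3)) +
       2 * C1 * C2 * (real n powr - (p1 + 1 - p2) * (\<Sum>k=1..n. real k powr - (p1 + p2)))) / \<epsilon>\<^sup>2)"
proof -
  let ?I = "{1..<n}"
  define d where "d = (\<Sum>i\<in>?I. expectation (\<lambda>\<omega>. (u i \<omega>)\<^sup>2))"
  \<comment> \<open>The order of the squared mean of the denominator, the common unit that
    \<open>Qx\<close> extracts from other powers of n.\<close>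
  define Q where "Q = real n powr (2 + 2 * p1)"
  define S where "S = (\<lambda>q. \<Sum>k=1..n. real k powr - q)"
  have n0: "real n > 0" using n by simp
  have Q: "Q > 0" using n0 by (simp add: Q_def)
  have Qx: "real n powr a = Q * real n powr b" if "a = 2 + 2 * p1 + b" for a b
    unfolding Q_def that by (rule powr_add)
  have g1: "gap i j \<ge> 1" for i j by (simp add: gap_def)
  have S0: "S q \<ge> 0" for q unfolding S_def by (rule sum_nonneg) simp
  have gp: "(real n / real (gap i j)) powr p \<ge> 0" for i j p by simp

  \<comment> \<open>n - 1 \<ge> n / 2 because n \<ge> 2, which explains \<kappa> / 2 below and then
    16 / \<kappa>^2.\<close>
  have "real n / 2 * (\<kappa> * real n powr p1) \<le> real (n - 1) * (\<kappa> * real n powr p1)"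
    using n pos by (intro mult_right_mono) (auto simp: of_nat_diff)
  also have "\<dots> = (\<Sum>i\<in>?I. \<kappa> * real n powr p1)" using n by simp
  also have "\<dots> \<le> d" unfolding d_def by (rule sum_mono) (rule low)
  finally have d_ge: "\<kappa> / 2 * real n powr (1 + p1) \<le> d" using n0 by (simp add: powr_add mult_ac)
  have e0: "\<kappa> / 2 * real n powr (1 + p1) > 0" using n0 pos by simp
  have d0: "d > 0" using d_ge e0 by linarith
  have "(\<kappa> / 2 * real n powr (1 + p1))\<^sup>2 \<le> d\<^sup>2"
    using d_ge e0 by (intro power_mono) auto
  also have "(\<kappa> / 2 * real n powr (1 + p1))\<^sup>2 = \<kappa>\<^sup>2 / 4 * Q"
    unfolding Q_def by (simp add: power2_eq_square flip: powr_add)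
  finally have "4 / d\<^sup>2 \<le> 4 / (\<kappa>\<^sup>2 / 4 * Q)"
    using pos Q d0 by (intro divide_left_mono) auto
  hence dQ: "4 / d\<^sup>2 \<le> 16 / \<kappa>\<^sup>2 / Q" by simp

  have "2 * (\<Sum>i\<in>?I. \<Sum>j\<in>?I. (expectation (\<lambda>\<omega>. u i \<omega> * u j \<omega>))\<^sup>2) \<le>
      2 * (\<Sum>i\<in>?I. \<Sum>j\<in>?I. C1\<^sup>2 * (real n / real (gap i j)) powr (2 * p1))"
  proof (intro mult_left_mono sum_mono)
    fix i j assume ij: "i \<in> ?I" "j \<in> ?I"
    have "(expectation (\<lambda>\<omega>. u i \<omega> * u j \<omega>))\<^sup>2 \<le> (C1 * (real n / real (gap i j)) powr p1)\<^sup>2"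
      using uu[OF ij] by (rule square_le_if_abs_le)
    thus "(expectation (\<lambda>\<omega>. u i \<omega> * u j \<omega>))\<^sup>2 \<le> C1\<^sup>2 * (real n / real (gap i j)) powr (2 * p1)"
      by (simp add: power2_eq_square mult_ac flip: powr_add)
  qed simp
  also have "\<dots> = 2 * (C1\<^sup>2 * (\<Sum>i\<in>?I. \<Sum>j\<in>?I. (real n / real (gap i j)) powr (2 * p1)))"
    by (simp add: sum_distrib_left)
  also have "\<dots> \<le> 2 * (C1\<^sup>2 * (2 * real n powr (1 + 2 * p1) * S (2 * p1)))"
    unfolding S_def using n by (intro mult_left_mono sum_gap_powr_le) auto
  also have "real n powr (1 + 2 * p1) = Q * real n powr - 1" by (rule Qx) simp
  finally have D: "expectation (\<lambda>\<omega>. ((\<Sum>i\<in>?I. (u i \<omega>)\<^sup>2) - d)\<^sup>2) \<le>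
      Q * (4 * C1\<^sup>2 * (real n powr - 1 * S (2 * p1)))"
    unfolding d_def by (subst expectation_centered_sum_squares(2)) (use u in \<open>auto simp: mult_ac\<close>)

  \<comment> \<open>For the covariances between u and w the decay is given up: p3 < p1 will be
    enough.\<close>
  have le_n: "(real n / real (gap i j)) powr p3 \<le> real n powr p3" for i j
    using g1[of i j] n0 pos by (intro powr_mono2) (auto simp: field_simps)
  have uw': "\<bar>expectation (\<lambda>\<omega>. u i \<omega> * w j \<omega>)\<bar> \<le> C3 * real n powr p3" if "i \<in> ?I" "j \<in> ?I" for i j
    using uw[OF that] mult_left_mono[OF le_n[of i j] pos(5)] by linarith
  have nn: "(real n * (C3 * real n powr p3))\<^sup>2 = Q * (C3\<^sup>2 * real n powr - (2 * (p1 - p3)))"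
  proof -
    have "real n powr (2 + 2 * p3) = real n powr ((1 + p3) + (1 + p3))" by simp
    also have "\<dots> = (real n * real n powr p3)\<^sup>2"
      using n0 unfolding powr_add by (simp add: power2_eq_square)
    finally have "(real n * (C3 * real n powr p3))\<^sup>2 = C3\<^sup>2 * real n powr (2 + 2 * p3)"
      by (simp add: power_mult_distrib mult_ac)
    also have "real n powr (2 + 2 * p3) = Q * real n powr - (2 * (p1 - p3))"
      by (rule Qx) (simp add: algebra_simps)
    finally show ?thesis by (simp add: mult_ac)
  qed
  have "\<bar>\<Sum>i\<in>?I. expectation (\<lambda>\<omega>. u i \<omega> * w i \<omega>)\<bar> \<le> (\<Sum>i\<in>?I. C3 * real n powr p3)"
    by (rule order_trans[OF sum_abs sum_mono]) (rule uw')
  also have "\<dots> \<le> real n * (C3 * real n powr p3)"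
    using pos by (simp add: mult_right_mono)
  finally have "(\<Sum>i\<in>?I. expectation (\<lambda>\<omega>. u i \<omega> * w i \<omega>))\<^sup>2 \<le> (real n * (C3 * real n powr p3))\<^sup>2"
    by (rule square_le_if_abs_le)
  hence N1: "(\<Sum>i\<in>?I. expectation (\<lambda>\<omega>. u i \<omega> * w i \<omega>))\<^sup>2 \<le> Q * (C3\<^sup>2 * real n powr - (2 * (p1 - p3)))"
    unfolding nn .
  \<comment> \<open>Here the decay of both factors is kept, so that their exponents add up to p1 +
    p2.\<close>
  have "(\<Sum>i\<in>?I. \<Sum>j\<in>?I. expectation (\<lambda>\<omega>. u i \<omega> * u j \<omega>) * expectation (\<lambda>\<omega>. w i \<omega> * w j \<omega>)) \<le>
      (\<Sum>i\<in>?I. \<Sum>j\<in>?I. C1 * C2 * (real n / real (gap i j)) powr (p1 + p2))"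
  proof (intro sum_mono)
    fix i j assume ij: "i \<in> ?I" "j \<in> ?I"
    have "\<bar>expectation (\<lambda>\<omega>. u i \<omega> * u j \<omega>) * expectation (\<lambda>\<omega>. w i \<omega> * w j \<omega>)\<bar> \<le>
      (C1 * (real n / real (gap i j)) powr p1) * (C2 * (real n / real (gap i j)) powr p2)"
      unfolding abs_mult using uu[OF ij] ww[OF ij] pos by (intro mult_mono) auto
    thus "expectation (\<lambda>\<omega>. u i \<omega> * u j \<omega>) * expectation (\<lambda>\<omega>. w i \<omega> * w j \<omega>) \<le>
        C1 * C2 * (real n / real (gap i j)) powr (p1 + p2)"
      by (simp add: powr_add mult_ac)
  qed
  also have "\<dots> = C1 * C2 * (\<Sum>i\<in>?I. \<Sum>j\<in>?I. (real n / real (gap i j)) powr (p1 + p2))"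
    by (simp add: sum_distrib_left)
  also have "\<dots> \<le> C1 * C2 * (2 * real n powr (1 + (p1 + p2)) * S (p1 + p2))"
    unfolding S_def using n pos by (intro mult_left_mono sum_gap_powr_le) auto
  also have "real n powr (1 + (p1 + p2)) = Q * real n powr - (p1 + 1 - p2)" by (rule Qx) simp
  finally have N2: "(\<Sum>i\<in>?I. \<Sum>j\<in>?I. expectation (\<lambda>\<omega>. u i \<omega> * u j \<omega>) * expectation (\<lambda>\<omega>. w i \<omega> * w j \<omega>)) \<le>
      Q * (2 * C1 * C2 * (real n powr - (p1 + 1 - p2) * S (p1 + p2)))"
    by (simp add: mult_ac)
  have "(\<Sum>i\<in>?I. \<Sum>j\<in>?I. expectation (\<lambda>\<omega>. u i \<omega> * w j \<omega>) * expectation (\<lambda>\<omega>. w i \<omega> * u j \<omega>)) \<le>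
      (\<Sum>i\<in>?I. \<Sum>j\<in>?I. (C3 * real n powr p3) * (C3 * real n powr p3))"
  proof (intro sum_mono)
    fix i j assume ij: "i \<in> ?I" "j \<in> ?I"
    have "expectation (\<lambda>\<omega>. w i \<omega> * u j \<omega>) = expectation (\<lambda>\<omega>. u j \<omega> * w i \<omega>)"
      by (simp add: mult.commute)
    hence "\<bar>expectation (\<lambda>\<omega>. u i \<omega> * w j \<omega>) * expectation (\<lambda>\<omega>. w i \<omega> * u j \<omega>)\<bar> \<le>
      (C3 * real n powr p3) * (C3 * real n powr p3)"
      unfolding abs_mult using uw'[OF ij] uw'[OF ij(2,1)] pos by (intro mult_mono) auto
    thus "expectation (\<lambda>\<omega>. u i \<omega> * w j \<omega>) * expectation (\<lambda>\<omega>. w i \<omega> * u j \<omega>) \<le>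
      (C3 * real n powr p3) * (C3 * real n powr p3)" by linarith
  qed
  also have "\<dots> = (real (n - 1) * (C3 * real n powr p3))\<^sup>2"
    using n by (simp add: power2_eq_square mult_ac of_nat_diff)
  also have "\<dots> \<le> (real n * (C3 * real n powr p3))\<^sup>2"
    using pos by (intro power_mono mult_right_mono) auto
  finally have N3: "(\<Sum>i\<in>?I. \<Sum>j\<in>?I. expectation (\<lambda>\<omega>. u i \<omega> * w j \<omega>) * expectation (\<lambda>\<omega>. w i \<omega> * u j \<omega>)) \<le>
      Q * (C3\<^sup>2 * real n powr - (2 * (p1 - p3)))"
    unfolding nn .
  have N: "expectation (\<lambda>\<omega>. (\<Sum>i\<in>?I. u i \<omega> * w i \<omega>)\<^sup>2) \<le>
      Q * (2 * C3\<^sup>2 * real n powr - (2 * (p1 - p3)) +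
       2 * C1 * C2 * (real n powr - (p1 + 1 - p2) * S (p1 + p2)))"
    using N1 N2 N3 expectation_sum_products_square(2)[of ?I u w] u w
    by (simp add: sum.distrib distrib_left)

  have "prob A \<le> 4 / d\<^sup>2 * (expectation (\<lambda>\<omega>. ((\<Sum>i\<in>?I. (u i \<omega>)\<^sup>2) - d)\<^sup>2) +
      expectation (\<lambda>\<omega>. (\<Sum>i\<in>?I. u i \<omega> * w i \<omega>)\<^sup>2) / \<epsilon>\<^sup>2)"
    by (rule prob_ratio_le[OF _ u w d_def d0 pos(2) A]) auto
  also have "\<dots> \<le> 16 / \<kappa>\<^sup>2 / Q * (Q * (4 * C1\<^sup>2 * (real n powr - 1 * S (2 * p1))) +
      Q * (2 * C3\<^sup>2 * real n powr - (2 * (p1 - p3)) +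
       2 * C1 * C2 * (real n powr - (p1 + 1 - p2) * S (p1 + p2))) / \<epsilon>\<^sup>2)"
    using pos Q dQ D N by (intro mult_mono add_mono divide_right_mono)
      (auto intro!: add_nonneg_nonneg divide_nonneg_nonneg integral_nonneg)
  also have "\<dots> = 16 / \<kappa>\<^sup>2 * (4 * C1\<^sup>2 * (real n powr - 1 * S (2 * p1)) +
      (2 * C3\<^sup>2 * real n powr - (2 * (p1 - p3)) +
       2 * C1 * C2 * (real n powr - (p1 + 1 - p2) * S (p1 + p2))) / \<epsilon>\<^sup>2)"
  proof -
    have "k / Q * (Q * x + Q * y / e) = k * (x + y / e)" for k x y e :: real
      using Q by (simp add: field_simps)
    thus ?thesis .
  qed
  finally show ?thesis unfolding S_def .
qed

section \<open>Reduction of the estimation error to a ratio, and the limit\<close>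

lemma second_difference_linear:
  "second_difference s (\<lambda>t. f t * b + g t) i = second_difference s f i * b + second_difference s g i"
  by (simp add: second_difference_def algebra_simps diff_divide_distrib add_divide_distrib)

lemma OLS_error:
  assumes "(\<Sum>i=1..n-1. (u i)\<^sup>2) > 0"
  shows "OLS n u (\<lambda>i. u i * b + w i) - b = (\<Sum>i=1..n-1. u i * w i) / (\<Sum>i=1..n-1. (u i)\<^sup>2)"
proof -
  have "(\<Sum>i=1..n-1. u i * (u i * b + w i)) = b * (\<Sum>i=1..n-1. (u i)\<^sup>2) + (\<Sum>i=1..n-1. u i * w i)"
    by (simp add: algebra_simps power2_eq_square sum.distrib sum_distrib_left)
  thus ?thesis using assms by (simp add: OLS_def add_divide_distrib)
qed

theorem theoremS1:
  fixes M :: "'w measure"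
    and X W Y :: "real \<Rightarrow> 'w \<Rightarrow> real"
    and K :: "real \<Rightarrow> real ^ 2 ^ 2"
    and c \<alpha> :: "real ^ 2 ^ 2"
    and L \<beta> m M' :: real
    and s :: "nat \<Rightarrow> nat \<Rightarrow> real"
  assumes "L > 0"
    and "stationary_gaussian_field M (\<lambda>t \<omega>. vector [X t \<omega>, W t \<omega>] :: real ^ 2) K"
    and "\<And>k l. condition_A L (c $ k $ l) (\<alpha> $ k $ l) (\<lambda>t. K t $ k $ l)"
    and "\<And>k. c $ k $ k \<noteq> 0"
    and "\<alpha> $ 1 $ 1 < \<alpha> $ 1 $ 2"
    and "\<And>t \<omega>. Y t \<omega> = X t \<omega> * \<beta> + W t \<omega>"
    and "0 < m" and "m \<le> M'"
    and "\<And>n. n \<ge> 1 \<Longrightarrow> s n 0 = 0"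
    and "\<And>n. n \<ge> 1 \<Longrightarrow> s n n = L"
    and "\<And>n i. i < n \<Longrightarrow> m / real n \<le> spacing (s n) i"
    and "\<And>n i. i < n \<Longrightarrow> spacing (s n) i \<le> M' / real n"
    and "\<alpha> $ 1 $ 1 < 4" and "\<alpha> $ 1 $ 1 \<noteq> 2"
    and "\<alpha> $ 2 $ 2 > \<alpha> $ 1 $ 1 - 1"
  shows "tendsto_in_prob M
           (\<lambda>n \<omega>. OLS n (second_difference (s n) (\<lambda>t. X t \<omega>))
                         (second_difference (s n) (\<lambda>t. Y t \<omega>))) \<beta>"
proof -
  define Z where "Z = (\<lambda>t \<omega>. vector [X t \<omega>, W t \<omega>] :: real ^ 2)"
  have Z: "stationary_gaussian_field M Z K" using assms(2) by (simp add: Z_def)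
  have Z12: "Z t \<omega> $ 1 = X t \<omega>" "Z t \<omega> $ 2 = W t \<omega>" for t \<omega>
    by (simp_all add: Z_def)
  define H where "H = {U \<in> field_span Z. integral\<^sup>L M U = 0}"
  interpret centered_gaussian_space M H
    unfolding H_def by (rule centered_gaussian_space_field_span)
      (use Z in \<open>auto simp: stationary_gaussian_field_def\<close>)
  define u where "u = (\<lambda>n i \<omega>. second_difference (s n) (\<lambda>t. X t \<omega>) i)"
  define w where "w = (\<lambda>n i \<omega>. second_difference (s n) (\<lambda>t. W t \<omega>) i)"
  have u: "u n i \<in> H" if "i \<ge> 1" for n i
    using second_difference_mem_field_span[OF that, of "s n" Z 1] expectation_second_difference[OF Z that that, of "s n" 1]
    by (simp add: H_def u_def Z12)
  have w: "w n i \<in> H" if "i \<ge> 1" for n i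
    using second_difference_mem_field_span[OF that, of "s n" Z 2] expectation_second_difference[OF Z that that, of "s n" 2]
    by (simp add: H_def w_def Z12)
  have cross: "expectation (\<lambda>\<omega>. u n i \<omega> * u n j \<omega>) = cross_difference (s n) (\<lambda>t. K t $ 1 $ 1) i j"
    "expectation (\<lambda>\<omega>. w n i \<omega> * w n j \<omega>) = cross_difference (s n) (\<lambda>t. K t $ 2 $ 2) i j"
    "expectation (\<lambda>\<omega>. u n i \<omega> * w n j \<omega>) = cross_difference (s n) (\<lambda>t. K t $ 1 $ 2) i j"
    if "i \<ge> 1" "j \<ge> 1" for n i j
    using expectation_second_difference_product[OF Z that, of "s n" 1 1]
      expectation_second_difference_product[OF Z that, of "s n" 2 2]
      expectation_second_difference_product[OF Z that, of "s n" 1 2]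
    by (simp_all add: u_def w_def Z12)
  have M': "M' > 0" using assms by linarith
  have grid: "quasi_uniform_grid n L m M' (s n)" if "n \<ge> 1" for n
    by unfold_locales (use assms that in auto)
  define p where "p = (\<lambda>k l. max (4 - \<alpha> $ k $ l) 0)"
  have "\<exists>C N. C \<ge> 0 \<and> (\<forall>n\<ge>N. \<forall>s. quasi_uniform_grid n L m M' s \<longrightarrow>
     (\<forall>i\<in>{1..<n}. \<forall>j\<in>{1..<n}.
       \<bar>cross_difference s (\<lambda>t. K t $ k $ l) i j\<bar> \<le> C * (real n / real (gap i j)) powr p k l))" for k l
    unfolding p_def by (rule cross_difference_upper[OF assms(1,7) M' assms(3)[of k l]]) blast
  then obtain C N where C: "\<And>k l. C k l \<ge> 0"
    and up: "\<And>k l n s i j. n \<ge> N k l \<Longrightarrow> quasi_uniform_grid n L m M' s \<Longrightarrow> i \<in> {1..<n} \<Longrightarrow> j \<in> {1..<n} \<Longrightarrow>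
       \<bar>cross_difference s (\<lambda>t. K t $ k $ l) i j\<bar> \<le> C k l * (real n / real (gap i j)) powr p k l"
    by metis
  obtain \<kappa> N0 where \<kappa>: "\<kappa> > 0" and low: "\<forall>n\<ge>N0. \<forall>s. quasi_uniform_grid n L m M' s \<longrightarrow>
     (\<forall>i\<in>{1..<n}. \<kappa> * real n powr (4 - \<alpha> $ 1 $ 1) \<le> \<bar>cross_difference s (\<lambda>t. K t $ 1 $ 1) i i\<bar>)"
    by (rule cross_difference_diagonal_lower[OF assms(1,7) M' assms(3)[of 1 1] assms(13,14,4)])
  have p11: "p 1 1 = 4 - \<alpha> $ 1 $ 1" "p 1 1 > 0" using assms(13) by (auto simp: p_def)
  have p12: "p 1 1 - p 1 2 > 0" "p 1 2 \<ge> 0" using assms(5,13) by (auto simp: p_def)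
  \<comment> \<open>For \<alpha>22 < 4 the first claim is precisely \<alpha>22 > \<alpha>11 - 1;
    otherwise p22 = 0 and p11 > 0 suffices.\<close>
  have p22: "p 1 1 + 1 - p 2 2 > 0" "p 2 2 \<ge> 0" using assms(13,15) by (auto simp: p_def)
  show ?thesis unfolding tendsto_in_prob_def
  proof (intro allI impI)
    fix \<epsilon> :: real assume \<epsilon>: "\<epsilon> > 0"
    define A where "A = (\<lambda>n. {\<omega> \<in> space M. \<bar>OLS n (second_difference (s n) (\<lambda>t. X t \<omega>))
                         (second_difference (s n) (\<lambda>t. Y t \<omega>)) - \<beta>\<bar> > \<epsilon>})"
    define b where "b = (\<lambda>n. 16 / \<kappa>\<^sup>2 * (4 * (C 1 1)\<^sup>2 * (real n powr - 1 * (\<Sum>k=1..n. real k powr - (2 * p 1 1))) +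
      (2 * (C 1 2)\<^sup>2 * real n powr - (2 * (p 1 1 - p 1 2)) +
       2 * C 1 1 * C 2 2 * (real n powr - (p 1 1 + 1 - p 2 2) * (\<Sum>k=1..n. real k powr - (p 1 1 + p 2 2)))) / \<epsilon>\<^sup>2))"
    have "(\<lambda>n. real n powr - (2 * (p 1 1 - p 1 2))) \<longlonglongrightarrow> 0"
      by (intro tendsto_neg_powr filterlim_real_sequentially) (use p12 in simp)
    \<comment> \<open>The pairs (q, d) are (2 p11, 1) for the denominator and (p11 + p22, p11 + 1 -
      p22) for the numerator; in both q + d = 2 p11 + 1 > 1.\<close>
    hence "b \<longlonglongrightarrow> 16 / \<kappa>\<^sup>2 * (4 * (C 1 1)\<^sup>2 * 0 + (2 * (C 1 2)\<^sup>2 * 0 + 2 * C 1 1 * C 2 2 * 0) / \<epsilon>\<^sup>2)"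
      unfolding b_def using p11 p22 \<epsilon>
      by (intro tendsto_intros powr_times_sum_powr_tendsto_0) auto
    hence b: "b \<longlonglongrightarrow> 0" by simp
    have "prob (A n) \<le> b n" if n: "n \<ge> Max {2, N0, N 1 1, N 2 2, N 1 2}" for n
    proof -
      have nn: "n \<ge> 2" "n \<ge> N0" "n \<ge> N 1 1" "n \<ge> N 2 2" "n \<ge> N 1 2" using n by auto
      have g: "quasi_uniform_grid n L m M' (s n)" using grid nn(1) by simp
      have eq: "{1..n - 1} = {1..<n}" using nn(1) by auto
      show ?thesis unfolding b_def
      proof (rule prob_ratio_le_gap[of n "u n" "w n"])
        show "\<kappa> * real n powr p 1 1 \<le> expectation (\<lambda>\<omega>. (u n i \<omega>)\<^sup>2)" if i: "i \<in> {1..<n}" for i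
        proof -
          have "expectation (\<lambda>\<omega>. (u n i \<omega>)\<^sup>2) = cross_difference (s n) (\<lambda>t. K t $ 1 $ 1) i i"
            using cross(1)[of i i n] i by (simp add: power2_eq_square)
          moreover have "expectation (\<lambda>\<omega>. (u n i \<omega>)\<^sup>2) \<ge> 0" by simp
          ultimately show ?thesis using low[rule_format, OF nn(2) g i] by (simp add: p11(1))
        qed
        show "A n \<subseteq> {\<omega> \<in> space M. (\<Sum>i\<in>{1..<n}. (u n i \<omega>)\<^sup>2) > 0 \<longrightarrow>
          \<bar>\<Sum>i\<in>{1..<n}. u n i \<omega> * w n i \<omega>\<bar> > \<epsilon> * (\<Sum>i\<in>{1..<n}. (u n i \<omega>)\<^sup>2)}"
        proof
          fix \<omega> assume \<omega>: "\<omega> \<in> A n"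
          have Y: "second_difference (s n) (\<lambda>t. Y t \<omega>) = (\<lambda>i. u n i \<omega> * \<beta> + w n i \<omega>)"
            by (rule ext) (simp add: assms(6) second_difference_linear u_def w_def)
          have X: "second_difference (s n) (\<lambda>t. X t \<omega>) = (\<lambda>i. u n i \<omega>)" by (simp add: u_def)
          have "\<bar>\<Sum>i\<in>{1..<n}. u n i \<omega> * w n i \<omega>\<bar> > \<epsilon> * (\<Sum>i\<in>{1..<n}. (u n i \<omega>)\<^sup>2)"
            if S: "(\<Sum>i\<in>{1..<n}. (u n i \<omega>)\<^sup>2) > 0"
          proof -
            have "\<bar>OLS n (\<lambda>i. u n i \<omega>) (\<lambda>i. u n i \<omega> * \<beta> + w n i \<omega>) - \<beta>\<bar> > \<epsilon>"
              using \<omega> unfolding A_def mem_Collect_eq X Y by simp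
            hence "\<bar>(\<Sum>i\<in>{1..<n}. u n i \<omega> * w n i \<omega>) / (\<Sum>i\<in>{1..<n}. (u n i \<omega>)\<^sup>2)\<bar> > \<epsilon>"
              using OLS_error[of "\<lambda>i. u n i \<omega>" n \<beta> "\<lambda>i. w n i \<omega>"] S unfolding eq by simp
            thus ?thesis using S by (simp add: abs_divide pos_less_divide_eq)
          qed
          thus "\<omega> \<in> {\<omega> \<in> space M. (\<Sum>i\<in>{1..<n}. (u n i \<omega>)\<^sup>2) > 0 \<longrightarrow>
            \<bar>\<Sum>i\<in>{1..<n}. u n i \<omega> * w n i \<omega>\<bar> > \<epsilon> * (\<Sum>i\<in>{1..<n}. (u n i \<omega>)\<^sup>2)}"
            using \<omega> by (auto simp: A_def)
        qed
      qed (use nn u w \<kappa> \<epsilon> C p12 up[OF _ g] cross in auto)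
    qed
    hence "eventually (\<lambda>n. norm (prob (A n)) \<le> b n) sequentially"
      unfolding eventually_sequentially by (intro exI[of _ "Max {2, N0, N 1 1, N 2 2, N 1 2}"]) auto
    hence "(\<lambda>n. prob (A n)) \<longlonglongrightarrow> 0"
      using b by (rule Lim_null_comparison)
    thus "(\<lambda>n. prob {\<omega> \<in> space M. \<bar>OLS n (second_difference (s n) (\<lambda>t. X t \<omega>))
                         (second_difference (s n) (\<lambda>t. Y t \<omega>)) - \<beta>\<bar> > \<epsilon>}) \<longlonglongrightarrow> 0"
      unfolding A_def .
  qed
qed

end
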